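(* Let $p$ be a prime and let $G$ be a finite $p$-solvable group. The following statements are equivalent: (1) $G\in\mathscr{N}_p\mathscr{U}_p$; (2) $G/N_{\mathscr{U}_p}(G)\in\mathscr{N}_p\mathscr{U}_p$.
   Context: All groups are finite. A group is $p$-solvable if each of its chief factors is a $p$-group or a $p'$-group, and $p$-supersolvable if each of its chief factors is either of order $p$ or a $p'$-group. $\mathscr{U}_p$ is the class of $p$-supersolvable groups and $\mathscr{N}_p$ the class of $p$-nilpotent groups (groups with a normal $p$-complement). For a group $T$, $T^{\mathscr{U}_p}$ is the intersection of all normal subgroups $N$ of $T$ with $T/N\in\mathscr{U}_p$. $\mathscr{N}_p\mathscr{U}_p$ is the class of groups $G$ with $G^{\mathscr{U}_p}\in\mathscr{N}_p$. The norm is $N_{\mathscr{U}_p}(G)=\bigcap_{T\le G}N_G(T^{\mathscr{U}_p})$, over all subgroups $T$ of $G$. *)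

theory Defs
  imports "HOL-Algebra.Algebra" "HOL-Computational_Algebra.Primes"
begin

text \<open>
  All groups are finite, so each class of groups below contains only finite groups.
  A subgroup \<open>H\<close> of \<open>G\<close>, regarded as a group, is \<open>G\<lparr>carrier := H\<rparr>\<close>; hence \<open>H/K\<close> is
  \<open>G\<lparr>carrier := H\<rparr> Mod K\<close>.
\<close>

definition finite_group :: "('a, 'b) monoid_scheme \<Rightarrow> bool" where
  "finite_group G \<longleftrightarrow> group G \<and> finite (carrier G)"

definition p_group :: "nat \<Rightarrow> ('a, 'b) monoid_scheme \<Rightarrow> bool" where
  "p_group p G \<longleftrightarrow> finite_group G \<and> (\<exists>n. order G = p ^ n)"

definition p'_group :: "nat \<Rightarrow> ('a, 'b) monoid_scheme \<Rightarrow> bool" where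
  "p'_group p G \<longleftrightarrow> finite_group G \<and> \<not> p dvd order G"

definition chief_factor :: "('a, 'b) monoid_scheme \<Rightarrow> 'a set \<Rightarrow> 'a set \<Rightarrow> bool" where
  "chief_factor G H K \<longleftrightarrow>
     H \<lhd> G \<and> K \<lhd> G \<and> K \<subset> H \<and> (\<nexists>L. L \<lhd> G \<and> K \<subset> L \<and> L \<subset> H)"

definition p_solvable :: "nat \<Rightarrow> ('a, 'b) monoid_scheme \<Rightarrow> bool" where
  "p_solvable p G \<longleftrightarrow> finite_group G \<and>
     (\<forall>H K. chief_factor G H K \<longrightarrow>
        p_group p (G\<lparr>carrier := H\<rparr> Mod K) \<or> p'_group p (G\<lparr>carrier := H\<rparr> Mod K))"

definition p_supersolvable :: "nat \<Rightarrow> ('a, 'b) monoid_scheme \<Rightarrow> bool" where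
  "p_supersolvable p G \<longleftrightarrow> finite_group G \<and>
     (\<forall>H K. chief_factor G H K \<longrightarrow>
        order (G\<lparr>carrier := H\<rparr> Mod K) = p \<or> p'_group p (G\<lparr>carrier := H\<rparr> Mod K))"

text \<open>A normal \<open>p\<close>-complement is a normal \<open>p'\<close>-subgroup of \<open>p\<close>-power index.\<close>

definition p_nilpotent :: "nat \<Rightarrow> ('a, 'b) monoid_scheme \<Rightarrow> bool" where
  "p_nilpotent p G \<longleftrightarrow> finite_group G \<and>
     (\<exists>K. K \<lhd> G \<and> p'_group p (G\<lparr>carrier := K\<rparr>) \<and> p_group p (G Mod K))"

text \<open>The residual $T^{\mathscr{U}_p}$.\<close>

definition Up_residual :: "nat \<Rightarrow> ('a, 'b) monoid_scheme \<Rightarrow> 'a set" where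
  "Up_residual p T = \<Inter> {N. N \<lhd> T \<and> p_supersolvable p (T Mod N)}"

text \<open>The class $\mathscr{N}_p\mathscr{U}_p$.\<close>

definition NpUp :: "nat \<Rightarrow> ('a, 'b) monoid_scheme \<Rightarrow> bool" where
  "NpUp p G \<longleftrightarrow> finite_group G \<and> p_nilpotent p (G\<lparr>carrier := Up_residual p G\<rparr>)"

text \<open>The norm $N_{\mathscr{U}_p}(G)$.\<close>

definition Up_norm :: "nat \<Rightarrow> ('a, 'b) monoid_scheme \<Rightarrow> 'a set" where
  "Up_norm p G = (\<Inter>T \<in> {T. subgroup T G}. normalizer G (Up_residual p (G\<lparr>carrier := T\<rparr>)))"

end

theory Submission
  imports Defs
begin

text \<open>
  Call \<open>G\<close> ``in $\mathscr{N}_p\mathscr{U}_p$ above \<open>Y\<close>'' if there are normal subgroups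
  \<open>Y \<le> D \<le> L\<close> of \<open>G\<close> with \<open>D/Y\<close> a \<open>p'\<close>-group, \<open>L/D\<close> a \<open>p\<close>-group and \<open>G/L\<close>
  \<open>p\<close>-supersolvable (\<open>NpUp_above\<close>). For \<open>Y = 1\<close> this is membership in the class, and the
  condition passes to images and preimages under epimorphisms. Images give the implication
  (1) to (2). Preimages turn (2) into the statement that \<open>G\<close> is in the class above its norm, and
  it remains to descend from the norm to the trivial group inside the fixed group \<open>G\<close>.

  One step of the descent (\<open>NpUp_above_descend\<close>) goes from a normal \<open>V \<noteq> 1\<close> inside the norm to
  a normal \<open>W\<close> such that \<open>V/W\<close> is a chief factor. If \<open>V/W\<close> is a \<open>p'\<close>-group, then so is
  \<open>D/W\<close>. Otherwise \<open>V/W\<close> is a minimal normal \<open>p\<close>-subgroup of \<open>G/W\<close>, hence abelian, and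
  its centralizer part $C_{V/W}(D)$ is normal in \<open>G/W\<close>, hence trivial or everything.

  If \<open>D\<close> centralizes \<open>V/W\<close>, then \<open>V/W\<close> has a normal complement \<open>E/W\<close> in \<open>D/W\<close>, and \<open>E\<close>
  replaces \<open>D\<close> (\<open>NpUp_above_central_step\<close>). If $C_{V/W}(D) = 1$, then \<open>V/W\<close> has a complement
  \<open>H/W\<close> in all of \<open>G/W\<close>. Here the norm enters: \<open>V\<close> normalizes the residual
  $S = H^{\mathscr{U}_p}$, so \<open>[S,V] \<le> S \<inter> V \<le> W\<close>, and \<open>G/SV\<close> is a quotient of \<open>H/S\<close>.
  Thus \<open>SV\<close> centralizes \<open>V/W\<close>, and intersecting \<open>D\<close> and \<open>L\<close> with \<open>SV\<close> leads back to the
  first case (\<open>NpUp_above_supplement_step\<close>).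

  Both complements come from one cocycle, obtained by averaging over the cosets of an abelian
  normal subgroup \<open>M\<close> of \<open>K\<close> with \<open>|M|\<close> and \<open>|K:M|\<close> coprime.
\<close>

section \<open>Subgroups, quotients and their orders\<close>

lemma (in group) inv_mult_cancel:
  assumes "x \<in> carrier G" "y \<in> carrier G"
  shows "inv x \<otimes> (x \<otimes> y) = y" "x \<otimes> (inv x \<otimes> y) = y"
  using assms by (simp_all flip: m_assoc)

lemma (in group) normal_carrier: "carrier G \<lhd> G"
  using normal_inv_iff subgroup_self by auto

lemma (in group) normal_update_iff:
  assumes "subgroup T G"
  shows "S \<lhd> G\<lparr>carrier := T\<rparr> \<longleftrightarrow>
    subgroup S G \<and> S \<subseteq> T \<and> (\<forall>x\<in>T. \<forall>s\<in>S. x \<otimes> s \<otimes> inv x \<in> S)"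
proof -
  interpret T: group "G\<lparr>carrier := T\<rparr>"
    by (rule subgroup_imp_group[OF assms])
  have "subgroup S (G\<lparr>carrier := T\<rparr>) \<longleftrightarrow> subgroup S G \<and> S \<subseteq> T"
    using incl_subgroup[OF assms] subgroup_incl[OF _ assms] subgroup.subset[of S "G\<lparr>carrier := T\<rparr>"]
    by auto
  then show ?thesis
    unfolding T.normal_inv_iff using m_inv_consistent[OF assms] by auto
qed

lemma (in group) card_subgroup_dvd:
  assumes "subgroup A G" "subgroup B G" "A \<subseteq> B"
  shows "card A dvd card B"
proof -
  have "subgroup A (G\<lparr>carrier := B\<rparr>)"
    using subgroup_incl assms by blast
  from group.lagrange[OF subgroup_imp_group[OF assms(2)] this] show ?thesis
      unfolding order_def by (simp, metis dvd_triv_right)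
qed

lemma (in group) card_subgroup_pos:
  assumes "subgroup A G" "finite (carrier G)"
  shows "card A > 0"
  using assms subgroup.finite_imp_card_positive by blast

lemma (in group) order_Mod_update:
  assumes "subgroup H G" "subgroup K G" "K \<subseteq> H"
  shows "order (G\<lparr>carrier := H\<rparr> Mod K) * card K = card H"
  using group.lagrange[OF subgroup_imp_group[OF assms(1)], of K] subgroup_incl[OF assms(2,1,3)]
  by (simp add: order_def FactGroup_def)

text \<open>Epimorphisms between finite groups carry all comparisons between a group and its quotients:
  the canonical projections, the conjugations, and the projections from supplements.\<close>

locale finite_epi = group_hom G H h for G (structure) and H (structure) and h +
  assumes surj: "h ` carrier G = carrier H" and fin: "finite (carrier G)"
begin

lemma fin_img: "finite (carrier H)"
  using surj fin finite_imageI by metis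

lemma normal_image:
  assumes "N \<lhd> G"
  shows "h ` N \<lhd> H"
  using normal.surj_hom_normal_subgroup[OF assms group_hom_axioms surj] .

lemma subgroup_vimage:
  assumes "subgroup L H"
  shows "subgroup (h -` L \<inter> carrier G) G"
proof (rule G.subgroupI)
  show "h -` L \<inter> carrier G \<noteq> {}"
    using subgroup.one_closed[OF assms] G.one_closed hom_one by (metis IntI empty_iff vimageI)
qed (use subgroup.m_inv_closed[OF assms] subgroup.m_closed[OF assms] in auto)

lemma normal_vimage:
  assumes "N \<lhd> H"
  shows "h -` N \<inter> carrier G \<lhd> G"
  using subgroup_vimage[OF normal_imp_subgroup[OF assms]] assms
  unfolding G.normal_inv_iff H.normal_inv_iff by auto

lemma card_image_kernel:
  assumes "subgroup L G"
  shows "card (h ` L) * card (L \<inter> kernel G H h) = card L"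
proof -
  interpret L: group_hom "G\<lparr>carrier := L\<rparr>" "H\<lparr>carrier := h ` L\<rparr>" h
    by (rule induced_group_hom[OF assms])
  have k: "kernel (G\<lparr>carrier := L\<rparr>) (H\<lparr>carrier := h ` L\<rparr>) h = L \<inter> kernel G H h"
    using subgroup.subset[OF assms] by (auto simp: kernel_def)
  have "(\<lambda>c. the_elem (h ` c)) \<in> iso (G\<lparr>carrier := L\<rparr> Mod (L \<inter> kernel G H h)) (H\<lparr>carrier := h ` L\<rparr>)"
    using L.FactGroup_iso_set unfolding k by simp
  then have "card (rcosets\<^bsub>G\<lparr>carrier := L\<rparr>\<^esub> (L \<inter> kernel G H h)) = card (h ` L)"
    unfolding iso_def FactGroup_def using bij_betw_same_card by fastforce
  then show ?thesis
    using L.G.lagrange[OF L.subgroup_kernel] unfolding k by (simp add: order_def)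
qed

lemma card_vimage_kernel:
  assumes "subgroup L H"
  shows "card (h -` L \<inter> carrier G) = card L * card (kernel G H h)"
proof -
  have "h ` (h -` L \<inter> carrier G) = L"
    using subgroup.subset[OF assms] unfolding surj[symmetric] by blast
  moreover have "(h -` L \<inter> carrier G) \<inter> kernel G H h = kernel G H h"
    using subgroup.one_closed[OF assms] by (auto simp: kernel_def)
  ultimately show ?thesis
    using card_image_kernel[OF subgroup_vimage[OF assms]] by metis
qed

end

lemma (in group) finite_epi_Mod:
  assumes "N \<lhd> G" "finite (carrier G)"
  shows "finite_epi G (G Mod N) (\<lambda>x. N #> x)"
  using normal.factorgroup_is_group[OF assms(1)] normal.r_coset_hom_Mod[OF assms(1)] assms
    carrier_FactGroup[of G N] group_axioms
  unfolding finite_epi_def finite_epi_axioms_def group_hom_def group_hom_axioms_def by simp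

lemma (in group) kernel_Mod:
  assumes "N \<lhd> G"
  shows "kernel G (G Mod N) (\<lambda>x. N #> x) = N"
proof -
  note sub = normal_imp_subgroup[OF assms]
  have "N #> x = N \<longleftrightarrow> x \<in> N" if "x \<in> carrier G" for x
    using coset_join1[OF _ that sub] coset_join2[OF that sub] by blast
  then show ?thesis
    using subgroup.subset[OF sub] by (auto simp: kernel_def)
qed

lemma (in group) vimage_Mod:
  assumes "subgroup N G" "x \<in> carrier G" "subgroup S G" "N #> x \<in> (\<lambda>x. N #> x) ` S"
  obtains n s where "n \<in> N" "s \<in> S" "x = n \<otimes> s"
proof -
  obtain s where s: "s \<in> S" "N #> x = N #> s"
    using assms(4) by auto
  have "x \<in> N #> s"
    using rcos_self[OF assms(2,1)] s by simp
  then show ?thesis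
    using that s unfolding r_coset_def by auto
qed

lemma (in group) normal_set_mult:
  assumes "A \<lhd> G" "B \<lhd> G"
  shows "A <#> B \<lhd> G"
proof -
  interpret A: normal A G by fact
  interpret B: normal B G by fact
  interpret AB: second_isomorphism_grp A G B
    by unfold_locales
  have "x \<otimes> c \<otimes> inv x \<in> A <#> B" if "x \<in> carrier G" "c \<in> A <#> B" for x c
  proof -
    obtain a b where ab: "a \<in> A" "b \<in> B" "c = a \<otimes> b"
      using \<open>c \<in> A <#> B\<close> unfolding set_mult_def by auto
    have "x \<otimes> c \<otimes> inv x = (x \<otimes> a \<otimes> inv x) \<otimes> (x \<otimes> b \<otimes> inv x)"
      using ab \<open>x \<in> carrier G\<close> by (simp add: m_assoc inv_mult_cancel)
    then show ?thesis
      using A.inv_op_closed2[OF that(1) ab(1)] B.inv_op_closed2[OF that(1) ab(2)]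
      unfolding set_mult_def by auto
  qed
  then show ?thesis
    using AB.normal_set_mult_subgroup unfolding normal_inv_iff by simp
qed

lemma (in group) set_mult_contains:
  assumes "subgroup A G" "subgroup B G"
  shows "A \<subseteq> A <#> B" "B \<subseteq> A <#> B"
proof -
  have "a \<in> A <#> B" if "a \<in> A" for a
    using that subgroup.one_closed[OF assms(2)] subgroup.mem_carrier[OF assms(1)] r_one[of a]
    unfolding set_mult_def by blast
  moreover have "b \<in> A <#> B" if "b \<in> B" for b
    using that subgroup.one_closed[OF assms(1)] subgroup.mem_carrier[OF assms(2)] l_one[of b]
    unfolding set_mult_def by blast
  ultimately show "A \<subseteq> A <#> B" "B \<subseteq> A <#> B"
    by blast+
qed

text \<open>The canonical projection modulo \<open>B\<close> has the same image on \<open>A\<close> and on \<open>AB\<close>; compare the kernels.\<close>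

lemma (in group) card_set_mult:
  assumes "A \<lhd> G" "B \<lhd> G" "finite (carrier G)"
  shows "card (A <#> B) * card (A \<inter> B) = card A * card B"
proof -
  interpret A: normal A G by fact
  interpret B: normal B G by fact
  interpret quot: finite_epi G "G Mod B" "\<lambda>x. B #> x"
    by (rule finite_epi_Mod[OF assms(2,3)])
  have "(\<lambda>x. B #> x) ` (A <#> B) = (\<lambda>x. B #> x) ` A"
  proof
    show "(\<lambda>x. B #> x) ` (A <#> B) \<subseteq> (\<lambda>x. B #> x) ` A"
    proof
      fix c assume "c \<in> (\<lambda>x. B #> x) ` (A <#> B)"
      then obtain a b where ab: "a \<in> A" "b \<in> B" "c = B #> (a \<otimes> b)"
        unfolding set_mult_def by auto
      have ac: "a \<in> carrier G" and bc: "b \<in> carrier G"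
        using ab A.subset B.subset by auto
      have "a \<otimes> b = (a \<otimes> b \<otimes> inv a) \<otimes> a"
        using ac bc by (simp add: m_assoc)
      then have "a \<otimes> b \<in> B #> a"
        using B.inv_op_closed2[OF ac ab(2)] unfolding r_coset_def by blast
      then have "B #> a = B #> (a \<otimes> b)"
        using repr_independence[OF _ ac B.subgroup_axioms] by blast
      then show "c \<in> (\<lambda>x. B #> x) ` A"
        using ab by blast
    qed
    show "(\<lambda>x. B #> x) ` A \<subseteq> (\<lambda>x. B #> x) ` (A <#> B)"
      using set_mult_contains(1)[OF A.subgroup_axioms B.subgroup_axioms] by (rule image_mono)
  qed
  moreover have "(A <#> B) \<inter> B = B"
    using set_mult_contains(2)[OF A.subgroup_axioms B.subgroup_axioms] by blast
  ultimately have 1: "card ((\<lambda>x. B #> x) ` A) * card B = card (A <#> B)"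
    using quot.card_image_kernel[OF normal_imp_subgroup[OF normal_set_mult[OF assms(1,2)]]]
    unfolding kernel_Mod[OF assms(2)] by (simp only:)
  have 2: "card ((\<lambda>x. B #> x) ` A) * card (A \<inter> B) = card A"
    using quot.card_image_kernel[OF A.subgroup_axioms]
    unfolding kernel_Mod[OF assms(2)] by (simp only:)
  show ?thesis
    unfolding 1[symmetric] 2[symmetric] by (simp only: mult_ac)
qed

section \<open>Complements from averaged cocycles\<close>

lemma (in group) update_pow:
  assumes "subgroup M G"
  shows "y [^]\<^bsub>G\<lparr>carrier := M\<rparr>\<^esub> (n::nat) = y [^] n"
  by (simp add: nat_pow_consistent[symmetric])

lemma (in group) power_card_subgroup:
  assumes "subgroup M G" "y \<in> M"
  shows "y [^] card M = \<one>"
  using group.pow_order_eq_1[OF subgroup_imp_group[OF assms(1)], of y] assms(2)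
  unfolding order_def by (simp add: update_pow[OF assms(1)])

lemma (in group) subgroup_pow_closed:
  assumes "subgroup M G" "y \<in> M"
  shows "y [^] (n::nat) \<in> M"
  using monoid.nat_pow_closed[OF group.is_monoid[OF subgroup_imp_group[OF assms(1)]], of y n] assms(2)
  by (simp add: update_pow[OF assms(1)])

lemma (in group) conj_pow:
  assumes "g \<in> carrier G" "x \<in> carrier G" "x [^] (n::nat) = \<one>"
  shows "(g \<otimes> x \<otimes> inv g) [^] n = \<one>"
proof -
  have "(g \<otimes> x \<otimes> inv g) [^] k = g \<otimes> x [^] k \<otimes> inv g" for k :: nat
    by (induction k) (use assms in \<open>simp_all add: m_assoc inv_mult_cancel\<close>)
  then show ?thesis
    using assms by simp
qed

text \<open>Raising to a power prime to the order is invertible: by Bezout some \<open>nu\<close> is \<open>1\<close> modulo \<open>|M|\<close>.\<close>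

lemma (in group) coprime_power_surj:
  assumes "subgroup M G" "coprime n (card M)" "y \<in> M"
  obtains m where "m \<in> M" "m [^] n = y"
proof (cases "n = 0")
  case True
  then have "card M = 1" using assms(2) by simp
  then obtain z where "M = {z}"
    by (rule card_1_singletonE)
  then have "y = \<one>"
    using assms(3) subgroup.one_closed[OF assms(1)] by blast
  then show thesis using that[of y] assms(3) by simp
next
  case False
  have yG: "y \<in> carrier G"
    by (rule subgroup.mem_carrier[OF assms(1,3)])
  have "gcd n (card M) = 1"
    using assms(2) by simp
  then obtain u v where uv: "n * u = card M * v + 1"
    using bezout_nat[OF False, of "card M"] by auto
  have "(y [^] u) [^] n = y [^] (n * u)"
    using yG by (simp add: nat_pow_pow mult.commute)
  also have "\<dots> = (y [^] card M) [^] v \<otimes> y"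
    using yG unfolding uv by (simp add: nat_pow_pow nat_pow_mult[symmetric])
  also have "\<dots> = y"
    using yG by (simp add: power_card_subgroup[OF assms(1,3)])
  finally show thesis
    using that subgroup_pow_closed[OF assms(1,3)] by blast
qed

lemma (in group) coprime_power_one:
  assumes "subgroup M G" "coprime n (card M)" "m \<in> M" "m [^] n = \<one>"
  shows "m = \<one>"
proof -
  have mG: "m \<in> carrier G"
    by (rule subgroup.mem_carrier[OF assms(1,3)])
  have "ord m dvd card M" "ord m dvd n"
    using pow_eq_id[OF mG] assms(4) power_card_subgroup[OF assms(1,3)] by auto
  then have "ord m = 1"
    using assms(2) coprime_common_divisor_nat by blast
  then show ?thesis
    using ord_eq_1[OF mG] by simp
qed

text \<open>The kernel of a 1-cocycle with values in an abelian normal subgroup is a subgroup. As the cocycle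
  restricts to a bijective power map on \<open>M\<close>, its kernel avoids \<open>M\<close>, and every \<open>g\<close> can be corrected
  by an element of \<open>M\<close> to lie in it.\<close>

lemma (in group) complement_of_cocycle:
  assumes "M \<lhd> G" and ab: "\<And>x y. x \<in> M \<Longrightarrow> y \<in> M \<Longrightarrow> x \<otimes> y = y \<otimes> x"
    and d: "\<And>g. g \<in> carrier G \<Longrightarrow> d g \<in> M"
    and coc: "\<And>g h. g \<in> carrier G \<Longrightarrow> h \<in> carrier G \<Longrightarrow> d (g \<otimes> h) = (g \<otimes> d h \<otimes> inv g) \<otimes> d g"
    and pow: "\<And>m. m \<in> M \<Longrightarrow> d m = m [^] n"
    and cop: "coprime n (card M)"
  shows "\<exists>H. subgroup H G \<and> H \<inter> M = {\<one>} \<and> (\<forall>g\<in>carrier G. \<exists>m\<in>M. m \<otimes> g \<in> H)"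
proof -
  interpret M: normal M G by fact
  define H where "H = {g \<in> carrier G. d g = \<one>}"
  have one: "d \<one> = \<one>"
    using pow[OF M.one_closed] by simp
  have "subgroup H G"
  proof (rule subgroupI)
    show "H \<noteq> {}"
      using one by (auto simp: H_def)
    show "inv g \<in> H" if "g \<in> H" for g
    proof -
      have g: "g \<in> carrier G" "d g = \<one>"
        using that by (auto simp: H_def)
      have c: "d (inv g) \<in> carrier G"
        using M.mem_carrier[OF d] g(1) by blast
      have "d (inv g \<otimes> g) = (inv g \<otimes> d g \<otimes> inv (inv g)) \<otimes> d (inv g)"
        using coc g(1) by blast
      then have "d (inv g) = \<one>"
        using g c one by simp
      then show ?thesis
        using g by (simp add: H_def)
    qed
    show "g \<otimes> h \<in> H" if "g \<in> H" "h \<in> H" for g h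
      using that coc[of g h] by (simp add: H_def)
  qed (auto simp: H_def)
  moreover have "H \<inter> M = {\<one>}"
  proof -
    have "m = \<one>" if "m \<in> M" "d m = \<one>" for m
      using coprime_power_one[OF M.subgroup_axioms cop that(1)] pow that by simp
    then show ?thesis using one M.one_closed by (auto simp: H_def)
  qed
  moreover have "\<exists>m\<in>M. m \<otimes> g \<in> H" if g: "g \<in> carrier G" for g
  proof -
    obtain m where m: "m \<in> M" "m [^] n = inv (d g)"
      using coprime_power_surj[OF M.subgroup_axioms cop] d[OF g] M.m_inv_closed by metis
    have c: "m \<in> carrier G" "d g \<in> carrier G"
      using m d[OF g] M.mem_carrier by auto
    have "m \<otimes> d g \<otimes> inv m = d g"
      using ab[OF m(1) d[OF g]] c by (simp add: m_assoc)
    then have "d (m \<otimes> g) = \<one>"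
      using coc[OF c(1) g] pow[OF m(1)] m(2) c by simp
    then show ?thesis
      using m c g by (auto simp: H_def)
  qed
  ultimately show ?thesis by blast
qed

text \<open>In the applications \<open>G\<close> is a quotient group, \<open>M\<close> is a chief factor and \<open>K/M\<close> is a \<open>p'\<close>-group.\<close>

locale abelian_normal_section = group G for G (structure) +
  fixes M K
  assumes fin: "finite (carrier G)" and M: "M \<lhd> G" and K: "K \<lhd> G" and MK: "M \<subseteq> K"
    and ab: "\<And>x y. x \<in> M \<Longrightarrow> y \<in> M \<Longrightarrow> x \<otimes> y = y \<otimes> x"
begin

interpretation M: normal M G by (rule M)
interpretation K: normal K G by (rule K)

interpretation A: comm_group "G\<lparr>carrier := M\<rparr>"
  by (rule group.group_comm_groupI[OF subgroup_imp_group[OF M.subgroup_axioms]]) (simp add: ab)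

definition rep :: "'a \<Rightarrow> 'a" where
  "rep k = (SOME x. x \<in> k <# M)"

definition reps :: "'a set" where
  "reps = rep ` K"

lemma rep_in_coset:
  assumes "k \<in> carrier G"
  shows "\<exists>m\<in>M. rep k = k \<otimes> m"
proof -
  have "k \<otimes> \<one> \<in> k <# M"
    unfolding l_coset_def using M.one_closed by blast
  then have "rep k \<in> k <# M"
    unfolding rep_def by (rule someI)
  then show ?thesis
    unfolding l_coset_def by auto
qed

lemma rep_mult:
  assumes "k \<in> carrier G" "m \<in> M"
  shows "rep (k \<otimes> m) = rep k"
proof -
  have "k \<otimes> m \<in> k <# M"
    using assms unfolding l_coset_def by blast
  then have "k <# M = (k \<otimes> m) <# M"
    using l_repr_independence[OF _ assms(1) M.subgroup_axioms] by blast
  then show ?thesis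
    unfolding rep_def by simp
qed

lemma rep_eqD:
  assumes "k \<in> carrier G" "l \<in> carrier G" "rep k = rep l"
  shows "inv k \<otimes> l \<in> M"
proof -
  obtain m m' where m: "m \<in> M" "m' \<in> M" "k \<otimes> m = l \<otimes> m'"
    using rep_in_coset[OF assms(1)] rep_in_coset[OF assms(2)] assms(3) by auto
  have c: "m \<in> carrier G" "m' \<in> carrier G" using m by auto
  have "l = k \<otimes> m \<otimes> inv m'"
    using m c assms by (simp add: m_assoc)
  then have "inv k \<otimes> l = m \<otimes> inv m'"
    using c assms by (simp add: m_assoc inv_mult_cancel)
  then show ?thesis using m by simp
qed

lemma rep_eqI:
  assumes "k \<in> carrier G" "l \<in> carrier G" "inv k \<otimes> l \<in> M"
  shows "rep l = rep k"
  using rep_mult[OF assms(1,3)] assms(1,2) by (simp add: inv_mult_cancel)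

lemma rep_closed: "k \<in> K \<Longrightarrow> rep k \<in> K"
  using rep_in_coset[of k] MK by auto

lemma rep_rep: "k \<in> carrier G \<Longrightarrow> rep (rep k) = rep k"
  using rep_in_coset[of k] rep_mult[of k] by auto

lemma reps: "r \<in> reps \<Longrightarrow> r \<in> K \<and> r \<in> carrier G \<and> rep r = r"
  unfolding reps_def using rep_closed rep_rep by auto

lemma finite_reps: "finite reps"
  unfolding reps_def using fin K.subset finite_subset by blast

lemma card_reps: "card reps * card M = card K"
proof -
  have "bij_betw (\<lambda>(r, m). r \<otimes> m) (reps \<times> M) K"
  proof (rule bij_betw_imageI)
    show "inj_on (\<lambda>(r, m). r \<otimes> m) (reps \<times> M)"
    proof (rule inj_onI, clarsimp)
      fix r m r' m' assume *: "r \<in> reps" "m \<in> M" "r' \<in> reps" "m' \<in> M" "r \<otimes> m = r' \<otimes> m'"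
      then have "r = r'"
        using rep_mult[of r m] rep_mult[of r' m'] reps by metis
      then show "r = r' \<and> m = m'"
        using * reps[of r'] by auto
    qed
    have "k \<in> (\<lambda>(r, m). r \<otimes> m) ` (reps \<times> M)" if "k \<in> K" for k
    proof -
      have kG: "k \<in> carrier G"
        using that by (rule K.mem_carrier)
      obtain m where m: "m \<in> M" "rep k = k \<otimes> m"
        using rep_in_coset[OF kG] by blast
      have "rep k \<otimes> inv m = k"
        unfolding m(2) using kG M.mem_carrier[OF m(1)] by (simp add: m_assoc)
      moreover have "(rep k, inv m) \<in> reps \<times> M"
        using that m(1) by (simp add: reps_def)
      ultimately show ?thesis
        by (metis (no_types, lifting) case_prod_conv image_eqI)
    qed
    then show "(\<lambda>(r, m). r \<otimes> m) ` (reps \<times> M) = K"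
      using reps MK by auto
  qed
  then show ?thesis
    using bij_betw_same_card card_cartesian_product by metis
qed

lemma shift_closed:
  assumes "g \<in> carrier G" "h \<in> carrier G" "g \<otimes> inv h \<in> K" "r \<in> K"
  shows "inv g \<otimes> r \<otimes> h \<in> K"
proof -
  have "inv g \<otimes> r \<otimes> h = inv g \<otimes> (r \<otimes> inv (g \<otimes> inv h)) \<otimes> g"
    using assms by (simp add: m_assoc inv_mult_group)
  then show ?thesis
    using K.inv_op_closed1[OF assms(1), of "r \<otimes> inv (g \<otimes> inv h)"] assms by simp
qed

text \<open>The pair \<open>(g, h)\<close> sends the coset \<open>rM\<close> to $g^{-1}rMh$, which permutes the cosets of \<open>M\<close> in
  \<open>K\<close> when $gh^{-1} \in K$; the statement is the same permutation on representatives.\<close>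

lemma shift_reps:
  assumes "g \<in> carrier G" "h \<in> carrier G" "g \<otimes> inv h \<in> K"
  shows "inj_on (\<lambda>r. rep (inv g \<otimes> r \<otimes> h)) reps" "(\<lambda>r. rep (inv g \<otimes> r \<otimes> h)) ` reps = reps"
proof -
  show i: "inj_on (\<lambda>r. rep (inv g \<otimes> r \<otimes> h)) reps"
  proof (rule inj_onI)
    fix r r' assume *: "r \<in> reps" "r' \<in> reps"
      "rep (inv g \<otimes> r \<otimes> h) = rep (inv g \<otimes> r' \<otimes> h)"
    have c: "r \<in> carrier G" "r' \<in> carrier G" using * reps by auto
    have "inv (inv g \<otimes> r \<otimes> h) \<otimes> (inv g \<otimes> r' \<otimes> h) \<in> M"
      by (rule rep_eqD) (use * c assms in auto)
    also have "inv (inv g \<otimes> r \<otimes> h) \<otimes> (inv g \<otimes> r' \<otimes> h) = inv h \<otimes> (inv r \<otimes> r') \<otimes> h"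
      using c assms by (simp add: m_assoc inv_mult_group inv_mult_cancel)
    finally have "h \<otimes> (inv h \<otimes> (inv r \<otimes> r') \<otimes> h) \<otimes> inv h \<in> M"
      using M.inv_op_closed2[OF assms(2)] by blast
    also have "h \<otimes> (inv h \<otimes> (inv r \<otimes> r') \<otimes> h) \<otimes> inv h = inv r \<otimes> r'"
      using c assms by (simp add: m_assoc inv_mult_cancel)
    finally show "r = r'"
      using rep_eqI[OF c] * reps by metis
  qed
  have "(\<lambda>r. rep (inv g \<otimes> r \<otimes> h)) ` reps \<subseteq> reps"
    using shift_closed[OF assms] reps unfolding reps_def by blast
  then show "(\<lambda>r. rep (inv g \<otimes> r \<otimes> h)) ` reps = reps"
    using i finite_reps endo_inj_surj by blast
qed

text \<open>The factor by which the system of representatives fails to be invariant under the pair \<open>(g, h)\<close>,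
  read off at the coset of \<open>r\<close>. Two independent sides are kept because the diagonal pairs \<open>(g, g)\<close>
  yield complements of fixed-point-free sections, and the pairs \<open>(k, 1)\<close> yield the transfer map.\<close>

definition defect :: "'a \<Rightarrow> 'a \<Rightarrow> 'a \<Rightarrow> 'a" where
  "defect g h r = g \<otimes> rep (inv g \<otimes> r \<otimes> h) \<otimes> inv h \<otimes> inv r"

definition cocycle :: "'a \<Rightarrow> 'a \<Rightarrow> 'a" where
  "cocycle g h = finprod (G\<lparr>carrier := M\<rparr>) (defect g h) reps"

lemma defect_closed:
  assumes "g \<in> carrier G" "h \<in> carrier G" "r \<in> carrier G"
  shows "defect g h r \<in> M"
proof -
  obtain m where m: "m \<in> M" "rep (inv g \<otimes> r \<otimes> h) = inv g \<otimes> r \<otimes> h \<otimes> m"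
    using rep_in_coset[of "inv g \<otimes> r \<otimes> h"] assms by auto
  have "defect g h r = (r \<otimes> h) \<otimes> m \<otimes> inv (r \<otimes> h)"
    using m assms by (simp add: defect_def m_assoc inv_mult_group inv_mult_cancel)
  then show ?thesis
    using M.inv_op_closed2[of "r \<otimes> h" m] m assms by simp
qed

lemma cocycle_closed:
  assumes "g \<in> carrier G" "h \<in> carrier G"
  shows "cocycle g h \<in> M"
  using A.finprod_closed[of "defect g h" reps] defect_closed[OF assms] reps
  by (auto simp: cocycle_def Pi_def)

lemma finprod_conj:
  assumes g: "g \<in> carrier G" and f: "f \<in> B \<rightarrow> M"
  shows "finprod (G\<lparr>carrier := M\<rparr>) (\<lambda>r. g \<otimes> f r \<otimes> inv g) B =
    g \<otimes> finprod (G\<lparr>carrier := M\<rparr>) f B \<otimes> inv g"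
  using f
proof (induction B rule: infinite_finite_induct)
  case (insert b B)
  have 1: "(\<lambda>r. g \<otimes> f r \<otimes> inv g) \<in> B \<rightarrow> M" "f \<in> B \<rightarrow> M" "f b \<in> M" "g \<otimes> f b \<otimes> inv g \<in> M"
    using insert.prems M.inv_op_closed2[OF g] by (auto simp: Pi_def)
  have 2: "finprod (G\<lparr>carrier := M\<rparr>) f B \<in> carrier G"
    using A.finprod_closed[of f B] 1 M.subset by auto
  have "finprod (G\<lparr>carrier := M\<rparr>) (\<lambda>r. g \<otimes> f r \<otimes> inv g) (insert b B) =
    (g \<otimes> f b \<otimes> inv g) \<otimes> finprod (G\<lparr>carrier := M\<rparr>) (\<lambda>r. g \<otimes> f r \<otimes> inv g) B"
    using A.finprod_insert[OF insert(1,2), of "\<lambda>r. g \<otimes> f r \<otimes> inv g"] 1 by simp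
  also have "\<dots> = g \<otimes> (f b \<otimes> finprod (G\<lparr>carrier := M\<rparr>) f B) \<otimes> inv g"
    using insert.IH 1 2 g M.mem_carrier[OF 1(3)] by (simp add: m_assoc inv_mult_cancel)
  also have "f b \<otimes> finprod (G\<lparr>carrier := M\<rparr>) f B = finprod (G\<lparr>carrier := M\<rparr>) f (insert b B)"
    using A.finprod_insert[OF insert(1,2), of f] 1 by simp
  finally show ?case .
qed (use g in auto)

text \<open>Termwise, the defect of a product is the defect of the second pair at the shifted coset, conjugated
  by \<open>g\<close>, times the defect of the first pair. Since the shift permutes the cosets, the product
  over all cosets no longer sees it.\<close>

lemma cocycle_mult:
  assumes g: "g \<in> carrier G" "h \<in> carrier G" "g \<otimes> inv h \<in> K"
    and g': "g' \<in> carrier G" "h' \<in> carrier G"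
  shows "cocycle (g \<otimes> g') (h \<otimes> h') = (g \<otimes> cocycle g' h' \<otimes> inv g) \<otimes> cocycle g h"
proof -
  let ?s = "\<lambda>r. rep (inv g \<otimes> r \<otimes> h)"
  have dm: "defect (g \<otimes> g') (h \<otimes> h') r = (g \<otimes> defect g' h' (?s r) \<otimes> inv g) \<otimes> defect g h r"
    if "r \<in> reps" for r
  proof -
    have r: "r \<in> carrier G" "r \<in> K" using reps that by auto
    obtain m where m: "m \<in> M" "?s r = inv g \<otimes> r \<otimes> h \<otimes> m"
      using rep_in_coset[of "inv g \<otimes> r \<otimes> h"] r g by auto
    have c: "m \<in> carrier G" "?s r \<in> carrier G"
      using m r g M.mem_carrier[OF m(1)] by auto
    have "rep (inv g' \<otimes> ?s r \<otimes> h') = rep (inv (g \<otimes> g') \<otimes> r \<otimes> (h \<otimes> h'))"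
    proof (rule rep_eqI)
      have "inv (inv (g \<otimes> g') \<otimes> r \<otimes> (h \<otimes> h')) \<otimes> (inv g' \<otimes> ?s r \<otimes> h') = inv h' \<otimes> m \<otimes> h'"
        unfolding m(2) using c r g g' by (simp add: m_assoc inv_mult_group inv_mult_cancel)
      then show "inv (inv (g \<otimes> g') \<otimes> r \<otimes> (h \<otimes> h')) \<otimes> (inv g' \<otimes> ?s r \<otimes> h') \<in> M"
        using M.inv_op_closed1[OF g'(2) m(1)] by simp
    qed (use c r g g' in auto)
    moreover have "rep (inv g' \<otimes> ?s r \<otimes> h') \<in> carrier G"
      using rep_in_coset[of "inv g' \<otimes> ?s r \<otimes> h'"] c g' M.mem_carrier by fastforce
    ultimately show ?thesis
      unfolding defect_def using c r g g' by (simp add: m_assoc inv_mult_group inv_mult_cancel)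
  qed
  have sr: "?s r \<in> reps" if "r \<in> reps" for r
    using shift_reps(2)[OF g] that by blast
  have cl: "defect g h \<in> reps \<rightarrow> M" "defect g' h' \<in> reps \<rightarrow> M"
    using defect_closed g g' reps by (auto simp: Pi_def)
  have cl': "(\<lambda>r. g \<otimes> defect g' h' r \<otimes> inv g) \<in> reps \<rightarrow> M"
    using cl(2) M.inv_op_closed2[OF g(1)] by (auto simp: Pi_def)
  have cl'': "(\<lambda>r. g \<otimes> defect g' h' (?s r) \<otimes> inv g) \<in> reps \<rightarrow> M"
    using cl' sr by (auto simp: Pi_def)
  have "cocycle (g \<otimes> g') (h \<otimes> h') =
    finprod (G\<lparr>carrier := M\<rparr>) (\<lambda>r. (g \<otimes> defect g' h' (?s r) \<otimes> inv g) \<otimes> defect g h r) reps"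
    unfolding cocycle_def
    by (rule A.finprod_cong') (use dm cl cl'' M.m_closed in \<open>auto simp: Pi_def\<close>)
  also have "\<dots> = finprod (G\<lparr>carrier := M\<rparr>) (\<lambda>r. g \<otimes> defect g' h' (?s r) \<otimes> inv g) reps \<otimes> cocycle g h"
    using A.finprod_multf[OF _ _, of "\<lambda>r. g \<otimes> defect g' h' (?s r) \<otimes> inv g" reps "defect g h"] cl cl''
    unfolding cocycle_def by simp
  also have "finprod (G\<lparr>carrier := M\<rparr>) (\<lambda>r. g \<otimes> defect g' h' (?s r) \<otimes> inv g) reps =
    finprod (G\<lparr>carrier := M\<rparr>) (\<lambda>r. g \<otimes> defect g' h' r \<otimes> inv g) reps"
    using A.finprod_reindex[of "\<lambda>r. g \<otimes> defect g' h' r \<otimes> inv g" ?s reps] shift_reps[OF g] cl'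
    by simp
  also have "\<dots> = g \<otimes> cocycle g' h' \<otimes> inv g"
    using finprod_conj[OF g(1) cl(2)] unfolding cocycle_def .
  finally show ?thesis .
qed

lemma finprod_const_pow:
  assumes "m \<in> M"
  shows "finprod (G\<lparr>carrier := M\<rparr>) (\<lambda>r. m) reps = m [^] card reps"
  using A.finprod_const[of m reps] assms by (simp add: nat_pow_consistent[symmetric])

text \<open>Left multiplication by \<open>m\<close> fixes every coset of \<open>M\<close>, so each factor of the product is \<open>m\<close>.\<close>

lemma cocycle_one:
  assumes "m \<in> M"
  shows "cocycle m \<one> = m [^] card reps"
proof -
  have "defect m \<one> r = m" if "r \<in> reps" for r
  proof -
    have r: "r \<in> carrier G" "rep r = r" using reps that by auto
    have m: "m \<in> carrier G" using assms by auto
    have "rep (inv m \<otimes> r) = rep r"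
    proof (rule rep_eqI)
      show "inv r \<otimes> (inv m \<otimes> r) \<in> M"
        using M.inv_op_closed1[of r "inv m"] r assms m by (simp add: m_assoc)
    qed (use r m in auto)
    then show ?thesis
      unfolding defect_def using r m by (simp add: m_assoc)
  qed
  then have "cocycle m \<one> = finprod (G\<lparr>carrier := M\<rparr>) (\<lambda>r. m) reps"
    unfolding cocycle_def by (intro A.finprod_cong') (use assms in auto)
  then show ?thesis
    using finprod_const_pow[OF assms] by simp
qed

text \<open>The product of the conjugates of \<open>y\<close> over \<open>K/M\<close> is fixed by \<open>K\<close>: conjugation by \<open>k\<close> permutes the conjugates
  of \<open>y\<close>, because replacing a representative by another one in its coset does not change how it
  acts on the abelian group \<open>M\<close>.\<close>

lemma norm_central:
  assumes "y \<in> M" "k \<in> K"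
  defines "N \<equiv> finprod (G\<lparr>carrier := M\<rparr>) (\<lambda>r. r \<otimes> y \<otimes> inv r) reps"
  shows "N \<in> M" "k \<otimes> N \<otimes> inv k = N"
proof -
  have kc: "k \<in> carrier G" "y \<in> carrier G" using assms by auto
  have cl: "(\<lambda>r. r \<otimes> y \<otimes> inv r) \<in> reps \<rightarrow> M"
    using M.inv_op_closed2 assms(1) reps by auto
  then show "N \<in> M"
    using A.finprod_closed[of "\<lambda>r. r \<otimes> y \<otimes> inv r" reps] unfolding N_def by simp
  let ?s = "\<lambda>r. rep (inv (inv k) \<otimes> r \<otimes> \<one>)"
  note s = shift_reps[of "inv k" \<one>]
  have "k \<otimes> N \<otimes> inv k = finprod (G\<lparr>carrier := M\<rparr>) (\<lambda>r. k \<otimes> (r \<otimes> y \<otimes> inv r) \<otimes> inv k) reps"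
    using finprod_conj[OF kc(1) cl] unfolding N_def by simp
  also have "\<dots> = finprod (G\<lparr>carrier := M\<rparr>) (\<lambda>r. ?s r \<otimes> y \<otimes> inv (?s r)) reps"
  proof (rule A.finprod_cong')
    fix r assume "r \<in> reps"
    then have r: "r \<in> carrier G" "r \<in> K" using reps by auto
    obtain m where m: "m \<in> M" "?s r = k \<otimes> r \<otimes> m"
      using rep_in_coset[of "k \<otimes> r"] r kc by auto
    have mc: "m \<in> carrier G" using m by auto
    have "m \<otimes> y \<otimes> inv m = y"
      using ab[OF m(1) assms(1)] mc kc by (simp add: m_assoc)
    moreover have "?s r \<otimes> y \<otimes> inv (?s r) = k \<otimes> (r \<otimes> (m \<otimes> y \<otimes> inv m) \<otimes> inv r) \<otimes> inv k"
      unfolding m(2) using mc kc r by (simp add: m_assoc inv_mult_group)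
    ultimately show "k \<otimes> (r \<otimes> y \<otimes> inv r) \<otimes> inv k = ?s r \<otimes> y \<otimes> inv (?s r)"
      by simp
  next
    show "(\<lambda>r. ?s r \<otimes> y \<otimes> inv (?s r)) \<in> reps \<rightarrow> carrier (G\<lparr>carrier := M\<rparr>)"
      using s cl kc assms by (auto simp: Pi_def)
  qed simp
  also have "\<dots> = N"
    using A.finprod_reindex[of "\<lambda>r. r \<otimes> y \<otimes> inv r" ?s reps] s cl kc assms
    unfolding N_def by simp
  finally show "k \<otimes> N \<otimes> inv k = N" .
qed

text \<open>The defect of \<open>(m, m)\<close> at \<open>r\<close> is the commutator \<open>[m, r]\<close>. The product of these is the power
  of \<open>m\<close> times the product of the conjugates of its inverse, which is fixed by
  \<open>K\<close> and so trivial, as \<open>K\<close> has no fixed points in \<open>M\<close>.\<close>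

lemma cocycle_diag:
  assumes m: "m \<in> M"
    and fpf: "\<And>y. y \<in> M \<Longrightarrow> \<forall>k\<in>K. k \<otimes> y \<otimes> inv k = y \<Longrightarrow> y = \<one>"
  shows "cocycle m m = m [^] card reps"
proof -
  have mc: "m \<in> carrier G" "inv m \<in> M" using m by auto
  have "defect m m r = m \<otimes> (r \<otimes> inv m \<otimes> inv r)" if "r \<in> reps" for r
  proof -
    have r: "r \<in> carrier G" "rep r = r" using reps that by auto
    have "rep (inv m \<otimes> r \<otimes> m) = rep r"
    proof (rule rep_eqI)
      have "inv r \<otimes> (inv m \<otimes> r \<otimes> m) = (inv r \<otimes> inv m \<otimes> r) \<otimes> m"
        using r mc by (simp add: m_assoc)
      then show "inv r \<otimes> (inv m \<otimes> r \<otimes> m) \<in> M"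
        using M.inv_op_closed1[OF r(1) mc(2)] m by simp
    qed (use r mc in auto)
    then show ?thesis
      unfolding defect_def using r mc by (simp add: m_assoc)
  qed
  moreover have cl: "(\<lambda>r. r \<otimes> inv m \<otimes> inv r) \<in> reps \<rightarrow> M"
    using M.inv_op_closed2 mc(2) reps by auto
  ultimately have "cocycle m m = finprod (G\<lparr>carrier := M\<rparr>) (\<lambda>r. m \<otimes> (r \<otimes> inv m \<otimes> inv r)) reps"
    unfolding cocycle_def by (intro A.finprod_cong') (use m in \<open>auto simp: Pi_def\<close>)
  also have "\<dots> = m [^] card reps \<otimes> finprod (G\<lparr>carrier := M\<rparr>) (\<lambda>r. r \<otimes> inv m \<otimes> inv r) reps"
    using A.finprod_multf[of "\<lambda>r. m" reps "\<lambda>r. r \<otimes> inv m \<otimes> inv r"] cl m finprod_const_pow[OF m]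
    by simp
  also have "finprod (G\<lparr>carrier := M\<rparr>) (\<lambda>r. r \<otimes> inv m \<otimes> inv r) reps = \<one>"
    using norm_central[OF mc(2)] fpf K.one_closed by blast
  finally show ?thesis
    using mc by simp
qed

text \<open>The complement is one in the whole group, although only \<open>|K:M|\<close> is prime to \<open>|M|\<close>: the group
  acts by conjugation on the systems of representatives in \<open>K\<close>, and \<open>H\<close> consists
  of the elements that move one such system with total defect \<open>1\<close>.\<close>

lemma fixed_point_free_complement:
  assumes fpf: "\<And>y. y \<in> M \<Longrightarrow> \<forall>k\<in>K. k \<otimes> y \<otimes> inv k = y \<Longrightarrow> y = \<one>"
    and n: "card K = n * card M" and cop: "coprime n (card M)"
  shows "\<exists>H. subgroup H G \<and> H \<inter> M = {\<one>} \<and> (\<forall>g\<in>carrier G. \<exists>m\<in>M. m \<otimes> g \<in> H)"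
proof (rule complement_of_cocycle[OF M ab])
  have "card M > 0"
    using card_subgroup_pos[OF M.subgroup_axioms fin] .
  then have "card reps = n"
    using card_reps n by simp
  then show "coprime (card reps) (card M)"
    using cop by simp
  show "cocycle g g \<in> M" if "g \<in> carrier G" for g
    using cocycle_closed that by simp
  show "cocycle (g \<otimes> h) (g \<otimes> h) = (g \<otimes> cocycle h h \<otimes> inv g) \<otimes> cocycle g g"
    if "g \<in> carrier G" "h \<in> carrier G" for g h
    using cocycle_mult[of g g h h] that K.one_closed by simp
  show "cocycle m m = m [^] card reps" if "m \<in> M" for m
    by (rule cocycle_diag[OF that fpf])
qed

text \<open>The transfer from \<open>K\<close> to the central subgroup \<open>M\<close> is a homomorphism with kernel a complement.
  The kernel consists of all elements of \<open>K\<close> of order dividing \<open>n\<close>, so it is normal even in \<open>G\<close>.\<close>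

lemma central_complement:
  assumes central: "\<And>k m. k \<in> K \<Longrightarrow> m \<in> M \<Longrightarrow> k \<otimes> m = m \<otimes> k"
    and n: "card K = n * card M" and cop: "coprime n (card M)"
  shows "\<exists>E. E \<lhd> G \<and> E \<subseteq> K \<and> card E = n"
proof -
  have pos: "card M > 0"
    using card_subgroup_pos[OF M.subgroup_axioms fin] .
  then have cr: "card reps = n"
    using card_reps n by simp
  interpret KG: group "G\<lparr>carrier := K\<rparr>"
    by (rule subgroup_imp_group[OF K.subgroup_axioms])
  have inv_eq: "inv\<^bsub>G\<lparr>carrier := K\<rparr>\<^esub> k = inv k" if "k \<in> K" for k
    by (rule m_inv_consistent[OF K.subgroup_axioms that])
  have "\<exists>D. subgroup D (G\<lparr>carrier := K\<rparr>) \<and> D \<inter> M = {\<one>\<^bsub>G\<lparr>carrier := K\<rparr>\<^esub>} \<and>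
    (\<forall>g\<in>carrier (G\<lparr>carrier := K\<rparr>). \<exists>m\<in>M. m \<otimes>\<^bsub>G\<lparr>carrier := K\<rparr>\<^esub> g \<in> D)"
  proof (rule KG.complement_of_cocycle[where d = "\<lambda>g. cocycle g \<one>" and n = n])
    show "M \<lhd> G\<lparr>carrier := K\<rparr>"
      by (rule normal_restrict_supergroup[OF K.subgroup_axioms M MK])
    show "cocycle g \<one> \<in> M" if "g \<in> carrier (G\<lparr>carrier := K\<rparr>)" for g
      using cocycle_closed that by simp
    show "cocycle (g \<otimes>\<^bsub>G\<lparr>carrier := K\<rparr>\<^esub> h) \<one> =
        g \<otimes>\<^bsub>G\<lparr>carrier := K\<rparr>\<^esub> cocycle h \<one> \<otimes>\<^bsub>G\<lparr>carrier := K\<rparr>\<^esub> inv\<^bsub>G\<lparr>carrier := K\<rparr>\<^esub> g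
        \<otimes>\<^bsub>G\<lparr>carrier := K\<rparr>\<^esub> cocycle g \<one>"
      if "g \<in> carrier (G\<lparr>carrier := K\<rparr>)" "h \<in> carrier (G\<lparr>carrier := K\<rparr>)" for g h
      using cocycle_mult[of g \<one> h \<one>] that inv_eq by simp
  qed (use ab cop cocycle_one cr in \<open>simp_all add: update_pow[OF K.subgroup_axioms]\<close>)
  then obtain D where D: "subgroup D (G\<lparr>carrier := K\<rparr>)" "D \<inter> M = {\<one>}"
    and DM: "\<And>k. k \<in> K \<Longrightarrow> \<exists>m\<in>M. m \<otimes> k \<in> D"
    by auto
  have DK: "D \<subseteq> K" and DG: "subgroup D G"
    using D(1) incl_subgroup[OF K.subgroup_axioms] subgroup.subset by force+
  have inj: "inj_on (\<lambda>(m, d). m \<otimes> d) (M \<times> D)"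
  proof (rule inj_onI, clarify)
    fix m d m' d' assume *: "m \<in> M" "d \<in> D" "m' \<in> M" "d' \<in> D" "m \<otimes> d = m' \<otimes> d'"
    have c: "m \<in> carrier G" "m' \<in> carrier G" "d \<in> carrier G" "d' \<in> carrier G"
      using * M.mem_carrier subgroup.mem_carrier[OF DG] by auto
    have "inv m' \<otimes> m = d' \<otimes> inv d"
    proof -
      have "m = m' \<otimes> d' \<otimes> inv d"
        using c by (simp add: m_assoc flip: *(5))
      then show ?thesis
        using c by (simp add: m_assoc inv_mult_cancel)
    qed
    moreover have "inv m' \<otimes> m \<in> M" "d' \<otimes> inv d \<in> D"
      using * subgroup.m_closed[OF DG] subgroup.m_inv_closed[OF DG] by auto
    ultimately have "inv m' \<otimes> m \<in> D \<inter> M"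
      by simp
    then have "inv m' \<otimes> m = \<one>"
      using D(2) by simp
    then have "m = m'"
      using c inv_mult_cancel(2)[of m' m] by simp
    then show "m = m' \<and> d = d'"
      using *(5) c by simp
  qed
  have "k \<in> (\<lambda>(m, d). m \<otimes> d) ` (M \<times> D)" if k: "k \<in> K" for k
  proof -
    obtain m where m: "m \<in> M" "m \<otimes> k \<in> D"
      using DM[OF k] by blast
    have 1: "inv m \<otimes> (m \<otimes> k) = k"
      by (rule inv_mult_cancel(1)[OF M.mem_carrier[OF m(1)] K.mem_carrier[OF k]])
    have 2: "(inv m, m \<otimes> k) \<in> M \<times> D"
      using m M.m_inv_closed[OF m(1)] by (simp only: mem_Times_iff fst_conv snd_conv)
    show ?thesis
      by (rule image_eqI[OF _ 2]) (simp only: 1 case_prod_conv)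
  qed
  moreover have "(\<lambda>(m, d). m \<otimes> d) ` (M \<times> D) \<subseteq> K"
  proof clarify
    fix m d assume "m \<in> M" "d \<in> D"
    then show "m \<otimes> d \<in> K"
      using MK DK K.m_closed[of m d] by blast
  qed
  ultimately have "(\<lambda>(m, d). m \<otimes> d) ` (M \<times> D) = K"
    by blast
  then have "card K = card M * card D"
    using card_image[OF inj] by (simp add: card_cartesian_product)
  then have cD: "card D = n"
    using n pos by simp
  \<comment> \<open>This description makes \<open>D\<close> invariant under conjugation by \<open>G\<close>.\<close>
  have "D = {x \<in> K. x [^] n = \<one>}"
  proof
    show "D \<subseteq> {x \<in> K. x [^] n = \<one>}"
      using power_card_subgroup[OF DG] cD DK by auto
    show "{x \<in> K. x [^] n = \<one>} \<subseteq> D"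
    proof clarify
      fix x assume x: "x \<in> K" "x [^] n = \<one>"
      obtain m where m: "m \<in> M" "m \<otimes> x \<in> D"
        using DM[OF x(1)] by blast
      have c: "m \<in> carrier G" "x \<in> carrier G"
        using m x M.mem_carrier K.mem_carrier by auto
      have "(m \<otimes> x) [^] n = m [^] n \<otimes> x [^] n"
        by (rule pow_mult_distrib[OF _ c]) (simp add: central[OF x(1) m(1)])
      then have "m [^] n = \<one>"
        using power_card_subgroup[OF DG m(2)] cD x c by simp
      then have "m = \<one>"
        using coprime_power_one[OF M.subgroup_axioms cop m(1)] by simp
      then show "x \<in> D"
        using m(2) c by simp
    qed
  qed
  then have "g \<otimes> x \<otimes> inv g \<in> D" if "g \<in> carrier G" "x \<in> D" for g x
    using that K.inv_op_closed2 conj_pow by auto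
  then have "D \<lhd> G"
    using DG normal_inv_iff by blast
  then show ?thesis
    using DK cD by blast
qed

end

section \<open>Normal series with \<open>p\<close>-supersolvable factors\<close>

text \<open>The orders allowed for a chief factor of a \<open>p\<close>-supersolvable group. Unlike the property of being a
  chief factor, for prime \<open>p\<close> this condition is inherited by divisors, so it survives intersections and images.\<close>

definition Up_index :: "nat \<Rightarrow> nat \<Rightarrow> bool" where
  "Up_index p d \<longleftrightarrow> d = p \<or> \<not> p dvd d"

lemma Up_index_dvd:
  assumes "Factorial_Ring.prime p" "Up_index p d" "e dvd d"
  shows "Up_index p e"
proof -
  have "e = 1 \<or> e = p" if "d = p"
    using assms(1,3) that prime_nat_iff by blast
  then show ?thesis
    using assms not_prime_1 dvd_trans unfolding Up_index_def by (metis nat_dvd_1_iff_1)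
qed

text \<open>A normal series of \<open>G\<close> from \<open>N\<close> up to the last argument; the steps need not be chief, and trivial
  steps are allowed. That such a series reaches \<open>carrier G\<close> expresses \<open>p\<close>-supersolvability of
  \<open>G/N\<close> without leaving \<open>G\<close>.\<close>

inductive Up_series :: "nat \<Rightarrow> ('a, 'b) monoid_scheme \<Rightarrow> 'a set \<Rightarrow> 'a set \<Rightarrow> bool"
  for p G N where
  refl: "N \<lhd> G \<Longrightarrow> Up_series p G N N"
| step: "Up_series p G N L \<Longrightarrow> L' \<lhd> G \<Longrightarrow> L \<subseteq> L' \<Longrightarrow> card L' = d * card L \<Longrightarrow>
    Up_index p d \<Longrightarrow> Up_series p G N L'"

lemma Up_series_normal:
  assumes "Up_series p G N L"
  shows "N \<lhd> G" "L \<lhd> G" "N \<subseteq> L"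
  using assms by (induction) auto

lemma Up_series_trans:
  assumes "Up_series p G L L'" "Up_series p G N L"
  shows "Up_series p G N L'"
  using assms by (induction) (auto intro: Up_series.step)

text \<open>$(L' \cap D)L$ lies between \<open>L\<close> and \<open>L'\<close> and has index $|L' \cap D : L \cap D|$ over \<open>L\<close>.\<close>

lemma (in group) index_Int:
  assumes "finite (carrier G)" "L \<lhd> G" "L' \<lhd> G" "D \<lhd> G" "L \<subseteq> L'" "card L' = d * card L"
  shows "\<exists>e. card (L' \<inter> D) = e * card (L \<inter> D) \<and> e dvd d"
proof -
  interpret L: normal L G by fact
  interpret L': normal L' G by fact
  interpret D: normal D G by fact
  have I: "L' \<inter> D \<lhd> G" "L \<inter> D \<lhd> G"
    using normal_subgroup_intersect assms by auto
  have "card (L \<inter> D) dvd card (L' \<inter> D)"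
    by (rule card_subgroup_dvd[OF normal_imp_subgroup[OF I(2)] normal_imp_subgroup[OF I(1)]])
      (use assms(5) in blast)
  then obtain e where e: "card (L' \<inter> D) = e * card (L \<inter> D)"
    by (metis dvdE mult.commute)
  have "(L' \<inter> D) <#> L \<subseteq> L'"
    using assms(5) L'.m_closed unfolding set_mult_def by blast
  then have "card ((L' \<inter> D) <#> L) dvd card L'"
    using card_subgroup_dvd[OF normal_imp_subgroup[OF normal_set_mult[OF I(1) assms(2)]]]
      L'.subgroup_axioms by blast
  then obtain j where j: "card L' = card ((L' \<inter> D) <#> L) * j"
    by (rule dvdE)
  have "(L' \<inter> D) \<inter> L = L \<inter> D"
    using assms(5) by blast
  then have "card ((L' \<inter> D) <#> L) * card (L \<inter> D) = (e * card (L \<inter> D)) * card L"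
    using card_set_mult[OF I(1) assms(2,1)] e by simp
  then have "card ((L' \<inter> D) <#> L) = e * card L"
    using card_subgroup_pos[OF normal_imp_subgroup[OF I(2)] assms(1)] by simp
  then have "d * card L = e * card L * j"
    using j assms(6) by metis
  then have "d * card L = (e * j) * card L"
    by (simp only: mult_ac)
  then have "d = e * j"
    using card_subgroup_pos[OF L.subgroup_axioms assms(1)] by simp
  then show ?thesis using e by auto
qed

text \<open>The index of the images times the index of the intersections with the kernel is \<open>d\<close>.\<close>

lemma (in finite_epi) index_image:
  assumes "L \<lhd> G" "L' \<lhd> G" "L \<subseteq> L'" "card L' = d * card L"
  shows "\<exists>e. card (h ` L') = e * card (h ` L) \<and> e dvd d"
proof -
  let ?k = "kernel G H h"
  note sub = normal_imp_subgroup[OF assms(1)] normal_imp_subgroup[OF assms(2)]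
  note im = subgroup_img_is_subgroup[OF sub(1)] subgroup_img_is_subgroup[OF sub(2)]
  obtain e where e: "card (h ` L') = card (h ` L) * e"
    using H.card_subgroup_dvd[OF im image_mono[OF assms(3)]] by (rule dvdE)
  obtain f where f: "card (L' \<inter> ?k) = f * card (L \<inter> ?k)"
    using G.index_Int[OF fin assms(1,2) normal_kernel assms(3,4)] by blast
  have "card (h ` L) * e * (f * card (L \<inter> ?k)) = d * (card (h ` L) * card (L \<inter> ?k))"
    using card_image_kernel[OF sub(1)] card_image_kernel[OF sub(2)] assms(4) unfolding e f by simp
  then have "(e * f) * (card (h ` L) * card (L \<inter> ?k)) = d * (card (h ` L) * card (L \<inter> ?k))"
    by (simp only: mult_ac)
  moreover have "card (h ` L) * card (L \<inter> ?k) > 0"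
    unfolding card_image_kernel[OF sub(1)] using G.card_subgroup_pos[OF sub(1) fin] .
  ultimately have "e * f = d"
    by simp
  then show ?thesis using e by (auto simp: mult.commute)
qed

lemma (in group) Up_series_Int:
  assumes "Factorial_Ring.prime p" "finite (carrier G)" "D \<lhd> G" "Up_series p G N L"
  shows "Up_series p G (N \<inter> D) (L \<inter> D)"
  using assms(4)
proof induction
  case refl
  then show ?case
    using normal_subgroup_intersect[OF _ assms(3)] by (simp add: Up_series.refl)
next
  case (step L L' d)
  obtain e where e: "card (L' \<inter> D) = e * card (L \<inter> D)" "e dvd d"
    using index_Int[OF assms(2) Up_series_normal(2)[OF step(1)] step(2) assms(3) step(3,4)] by blast
  show ?case
    using Up_series.step[OF step.IH normal_subgroup_intersect[OF step(2) assms(3)] _ e(1)]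
      Up_index_dvd[OF assms(1) step(5) e(2)] step(3) by blast
qed

lemma (in finite_epi) Up_series_image:
  assumes "Factorial_Ring.prime p" "Up_series p G N L"
  shows "Up_series p H (h ` N) (h ` L)"
  using assms(2)
proof induction
  case refl
  then show ?case
    by (simp add: Up_series.refl normal_image)
next
  case (step L L' d)
  obtain e where e: "card (h ` L') = e * card (h ` L)" "e dvd d"
    using index_image[OF Up_series_normal(2)[OF step(1)] step(2-4)] by blast
  show ?case
    using Up_series.step[OF step.IH normal_image[OF step(2)] image_mono[OF step(3)] e(1)]
      Up_index_dvd[OF assms(1) step(5) e(2)] by blast
qed

lemma (in finite_epi) Up_series_vimage:
  assumes "Up_series p H N L"
  shows "Up_series p G (h -` N \<inter> carrier G) (h -` L \<inter> carrier G)"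
  using assms
proof induction
  case refl
  then show ?case
    by (simp add: Up_series.refl normal_vimage)
next
  case (step L L' d)
  have "card (h -` L' \<inter> carrier G) = d * card (h -` L \<inter> carrier G)"
    using card_vimage_kernel[OF normal_imp_subgroup] step(2,4) Up_series_normal(2)[OF step(1)]
    by (metis mult.assoc)
  then show ?case
    using Up_series.step[OF step.IH normal_vimage[OF step(2)] _ _ step(5)] step(3) by blast
qed

lemma (in finite_epi) vimage_image:
  assumes "subgroup L G" "kernel G H h \<subseteq> L"
  shows "h -` (h ` L) \<inter> carrier G = L"
proof
  show "h -` (h ` L) \<inter> carrier G \<subseteq> L"
  proof
    fix x assume "x \<in> h -` (h ` L) \<inter> carrier G"
    then obtain l where l: "l \<in> L" "h x = h l" "x \<in> carrier G"
      by auto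
    have lG: "l \<in> carrier G"
      using subgroup.mem_carrier[OF assms(1) l(1)] .
    have "x \<otimes> inv l \<in> kernel G H h"
      using l lG by (simp add: kernel_def)
    then have "x \<otimes> inv l \<otimes> l \<in> L"
      using assms(2) subgroup.m_closed[OF assms(1) _ l(1)] by blast
    then show "x \<in> L"
      using l lG by (simp add: G.m_assoc)
  qed
  show "L \<subseteq> h -` (h ` L) \<inter> carrier G"
    using subgroup.subset[OF assms(1)] by auto
qed

lemma (in finite_epi) kernel_eq_vimage: "kernel G H h = h -` {\<one>\<^bsub>H\<^esub>} \<inter> carrier G"
  by (auto simp: kernel_def)

lemma (in group) finite_group_factor:
  assumes "finite (carrier G)" "subgroup H G" "K \<lhd> G" "K \<subseteq> H"
  shows "finite_group (G\<lparr>carrier := H\<rparr> Mod K)"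
proof -
  have "group (G\<lparr>carrier := H\<rparr> Mod K)"
    using normal.factorgroup_is_group[OF normal_restrict_supergroup[OF assms(2,3,4)]] .
  moreover have "finite H"
    using assms(1) subgroup.subset[OF assms(2)] finite_subset by blast
  then have "finite (carrier (G\<lparr>carrier := H\<rparr> Mod K))"
    using carrier_FactGroup[of "G\<lparr>carrier := H\<rparr>" K] by simp
  ultimately show ?thesis
    by (simp add: finite_group_def)
qed

text \<open>A series that starts at the bottom of a chief factor and stays inside it makes at most one jump.\<close>

lemma (in group) chief_factor_Up_series:
  assumes "Up_series p G K L" "chief_factor G H K" "L \<subseteq> H"
  shows "L = K \<or> (L = H \<and> (\<exists>d. card H = d * card K \<and> Up_index p d))"
  using assms(1,3)
proof induction
  case refl
  then show ?case by simp
next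
  case (step L L' d)
  have sub: "K \<subseteq> L'" "L \<subseteq> H"
    using Up_series_normal(3)[OF step(1)] step(3) step.prems by auto
  have "\<not> (K \<subset> L' \<and> L' \<subset> H)"
    using assms(2) step(2) unfolding chief_factor_def by metis
  then have "L' = K \<or> L' = H"
    using sub(1) step.prems by auto
  moreover have "L = K \<or> L = H"
    using step.IH sub(2) by auto
  ultimately show ?case
    using step.IH[OF sub(2)] sub step(3-5) step.prems by auto
qed

text \<open>From the chief factor condition, a series of the required kind with maximal end must end at
  \<open>carrier G\<close>. Conversely, intersecting a given series with \<open>H\<close> and multiplying by \<open>K\<close> turns it
  into one that runs from \<open>K\<close> to \<open>H\<close> for any chief factor \<open>H/K\<close>. The multiplication is done
  by passing to \<open>G/K\<close> and back.\<close>

lemma (in group) p_supersolvable_iff_Up_series: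
  assumes "Factorial_Ring.prime p" "finite (carrier G)"
  shows "p_supersolvable p G \<longleftrightarrow> Up_series p G {\<one>} (carrier G)"
proof
  assume ss: "p_supersolvable p G"
  let ?S = "{L. Up_series p G {\<one>} L}"
  have "?S \<subseteq> Pow (carrier G)"
    using Up_series_normal(2) normal_imp_subgroup subgroup.subset by blast
  then have finS: "finite ?S"
    using assms(2) finite_subset by blast
  have "{\<one>} \<in> ?S"
    using Up_series.refl[OF one_is_normal] by simp
  then obtain L where L: "Up_series p G {\<one>} L" and
    max: "\<And>L'. Up_series p G {\<one>} L' \<Longrightarrow> L \<subseteq> L' \<Longrightarrow> L' = L"
    using finite_has_maximal[OF finS] by (metis (lifting) empty_iff mem_Collect_eq)
  note Ln = Up_series_normal(2)[OF L]
  have LG: "L \<subseteq> carrier G"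
    using subgroup.subset[OF normal_imp_subgroup[OF Ln]] .
  show "Up_series p G {\<one>} (carrier G)"
  proof (cases "L = carrier G")
    case False
    let ?T = "{M. M \<lhd> G \<and> L \<subset> M}"
    have "?T \<subseteq> Pow (carrier G)"
      using normal_imp_subgroup subgroup.subset by blast
    then have finT: "finite ?T"
      using assms(2) finite_subset by blast
    have "carrier G \<in> ?T"
      using normal_carrier LG False by blast
    then obtain M where M: "M \<lhd> G" "L \<subset> M" and min: "\<And>M'. M' \<lhd> G \<Longrightarrow> L \<subset> M' \<Longrightarrow> M' \<subseteq> M \<Longrightarrow> M' = M"
      using finite_has_minimal[OF finT] by (metis (lifting) empty_iff mem_Collect_eq)
    \<comment> \<open>A minimal normal subgroup above \<open>L\<close> would extend the series.\<close>
    have "chief_factor G M L"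
      unfolding chief_factor_def using M Ln min by blast
    then have "Up_index p (order (G\<lparr>carrier := M\<rparr> Mod L))"
      using ss unfolding p_supersolvable_def p'_group_def Up_index_def by blast
    moreover have "card M = order (G\<lparr>carrier := M\<rparr> Mod L) * card L"
      using order_Mod_update[OF normal_imp_subgroup normal_imp_subgroup] M Ln by auto
    ultimately have "Up_series p G {\<one>} M"
      using Up_series.step[OF L M(1)] M(2) by blast
    then show ?thesis
      using max[of M] M(2) by blast
  qed (use L in simp)
next
  assume ser: "Up_series p G {\<one>} (carrier G)"
  show "p_supersolvable p G"
    unfolding p_supersolvable_def
  proof (intro conjI allI impI)
    show "finite_group G"
      using assms(2) group_axioms by (simp add: finite_group_def)
    fix H K assume ch: "chief_factor G H K"
    then have HK: "H \<lhd> G" "K \<lhd> G" "K \<subset> H"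
      unfolding chief_factor_def by auto
    note sub = normal_imp_subgroup[OF HK(1)] normal_imp_subgroup[OF HK(2)]
    interpret quot: finite_epi G "G Mod K" "\<lambda>x. K #> x"
      by (rule finite_epi_Mod[OF HK(2) assms(2)])
    have "{\<one>} \<inter> H = {\<one>}" "carrier G \<inter> H = H"
      using subgroup.one_closed[OF sub(1)] subgroup.subset[OF sub(1)] by auto
    then have "Up_series p G {\<one>} H"
      using Up_series_Int[OF assms HK(1) ser] by simp
    then have "Up_series p (G Mod K) ((\<lambda>x. K #> x) ` {\<one>}) ((\<lambda>x. K #> x) ` H)"
      by (rule quot.Up_series_image[OF assms(1)])
    then have "Up_series p G ((\<lambda>x. K #> x) -` {\<one>\<^bsub>G Mod K\<^esub>} \<inter> carrier G)
        ((\<lambda>x. K #> x) -` ((\<lambda>x. K #> x) ` H) \<inter> carrier G)"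
      using quot.Up_series_vimage[of p "{\<one>\<^bsub>G Mod K\<^esub>}"] subgroup.subset[OF sub(2)] by simp
    then have "Up_series p G K H"
      using quot.vimage_image[OF sub(1)] HK(3) quot.kernel_eq_vimage kernel_Mod[OF HK(2)] by simp
    then obtain d where d: "card H = d * card K" "Up_index p d"
      using chief_factor_Up_series[OF _ ch] HK(3) by blast
    have "order (G\<lparr>carrier := H\<rparr> Mod K) = d"
      using order_Mod_update[OF sub] HK(3) d(1) card_subgroup_pos[OF sub(2) assms(2)] by simp
    then show "order (G\<lparr>carrier := H\<rparr> Mod K) = p \<or> p'_group p (G\<lparr>carrier := H\<rparr> Mod K)"
      using d(2) finite_group_factor[OF assms(2) sub(1) HK(2)] HK(3)
      unfolding Up_index_def p'_group_def by auto
  qed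
qed

lemma (in group) p_supersolvable_Mod_iff:
  assumes "Factorial_Ring.prime p" "finite (carrier G)" "N \<lhd> G"
  shows "p_supersolvable p (G Mod N) \<longleftrightarrow> Up_series p G N (carrier G)"
proof -
  interpret quot: finite_epi G "G Mod N" "\<lambda>x. N #> x"
    by (rule finite_epi_Mod[OF assms(3,2)])
  interpret N: normal N G by fact
  have "(\<lambda>x. N #> x) ` N = (\<lambda>x. N) ` N"
    by (rule image_cong[OF HOL.refl]) (rule N.rcos_const[OF group_axioms])
  then have im: "(\<lambda>x. N #> x) ` N = {N}"
    unfolding image_constant_conv using N.one_closed by (metis empty_iff)
  have "Up_series p G N (carrier G)" if "Up_series p (G Mod N) {N} (carrier (G Mod N))"
  proof -
    have "(\<lambda>x. N #> x) -` carrier (G Mod N) \<inter> carrier G = carrier G"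
      using quot.hom_closed by blast
    then show ?thesis
      using quot.Up_series_vimage[OF that] quot.kernel_eq_vimage kernel_Mod[OF assms(3)] by simp
  qed
  moreover have "Up_series p (G Mod N) {N} (carrier (G Mod N))" if "Up_series p G N (carrier G)"
    using quot.Up_series_image[OF assms(1) that] unfolding im quot.surj .
  ultimately show ?thesis
    using quot.H.p_supersolvable_iff_Up_series[OF assms(1) quot.fin_img] by auto
qed

lemma (in group) Up_residual_eq:
  assumes "Factorial_Ring.prime p" "finite (carrier G)"
  shows "Up_residual p G = \<Inter>{N. Up_series p G N (carrier G)}"
  unfolding Up_residual_def using p_supersolvable_Mod_iff[OF assms] Up_series_normal(1)
  by (metis (lifting))

text \<open>The class of \<open>p\<close>-supersolvable groups is a formation: if series start at \<open>N\<close> and at \<open>N'\<close>, then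
  intersecting the second with \<open>N\<close> and continuing along the first gives one from their intersection.
  Hence a minimal starting point is the least one.\<close>

lemma (in group) Up_series_residual:
  assumes "Factorial_Ring.prime p" "finite (carrier G)"
  shows "Up_series p G (Up_residual p G) (carrier G)"
proof -
  let ?S = "{N. Up_series p G N (carrier G)}"
  have "?S \<subseteq> Pow (carrier G)"
    using Up_series_normal(3) by blast
  then have finS: "finite ?S"
    using assms(2) finite_subset by blast
  have "carrier G \<in> ?S"
    using Up_series.refl[OF normal_carrier] by simp
  then obtain N where N: "Up_series p G N (carrier G)" and
    min: "\<And>N'. Up_series p G N' (carrier G) \<Longrightarrow> N' \<subseteq> N \<Longrightarrow> N' = N"
    using finite_has_minimal[OF finS] by (metis (lifting) empty_iff mem_Collect_eq)
  have "N \<subseteq> N'" if N': "Up_series p G N' (carrier G)" for N'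
  proof -
    note n = Up_series_normal(1)[OF N]
    have "carrier G \<inter> N = N"
      using Up_series_normal(3)[OF N] by blast
    then have "Up_series p G (N' \<inter> N) N"
      using Up_series_Int[OF assms n N'] by simp
    then have "Up_series p G (N' \<inter> N) (carrier G)"
      by (rule Up_series_trans[OF N])
    then show ?thesis
      using min by blast
  qed
  then have "Up_residual p G = N"
    unfolding Up_residual_eq[OF assms] using N by blast
  then show ?thesis
    using N by simp
qed

lemma (in group) Up_residual_subset:
  assumes "Factorial_Ring.prime p" "finite (carrier G)" "Up_series p G N (carrier G)"
  shows "Up_residual p G \<subseteq> N"
  unfolding Up_residual_eq[OF assms(1,2)] using assms(3) by blast

lemma (in finite_epi) Up_residual_image:
  assumes "Factorial_Ring.prime p"
  shows "h ` Up_residual p G \<subseteq> Up_residual p H"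
proof -
  have "h -` carrier H \<inter> carrier G = carrier G"
    by auto
  then have "Up_series p G (h -` Up_residual p H \<inter> carrier G) (carrier G)"
    using Up_series_vimage[OF H.Up_series_residual[OF assms fin_img]] by simp
  then show ?thesis
    using G.Up_residual_subset[OF assms fin] by blast
qed

section \<open>The class \<open>N\<^sub>pU\<^sub>p\<close> relative to a normal subgroup\<close>

text \<open>The subgroup \<open>L\<close> is any normal subgroup with \<open>p\<close>-supersolvable quotient, not the residual itself:
  this makes the condition easy to transport, and intersecting with the residual recovers the class.\<close>

definition NpUp_above :: "nat \<Rightarrow> ('a, 'b) monoid_scheme \<Rightarrow> 'a set \<Rightarrow> bool" where
  "NpUp_above p G Y \<longleftrightarrow> (\<exists>D L d n. D \<lhd> G \<and> L \<lhd> G \<and> Y \<subseteq> D \<and> D \<subseteq> L \<and> Up_series p G L (carrier G) \<and>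
     card D = d * card Y \<and> \<not> p dvd d \<and> card L = p ^ n * card D)"

lemma (in group) normal_Hall_eq:
  assumes "K \<lhd> G" "coprime (card K) (order (G Mod K))"
  shows "K = {x \<in> carrier G. x [^] card K = \<one>}"
proof -
  interpret K: normal K G by fact
  interpret Q: group "G Mod K"
    by (rule K.factorgroup_is_group)
  interpret quot: group_hom G "G Mod K" "\<lambda>x. K #> x"
    using K.r_coset_hom_Mod by unfold_locales
  have "x \<in> K" if x: "x \<in> carrier G" "x [^] card K = \<one>" for x
  proof -
    have "(K #> x) [^]\<^bsub>G Mod K\<^esub> card K = K #> x [^] card K"
      using quot.hom_nat_pow[OF x(1)] by simp
    also have "\<dots> = \<one>\<^bsub>G Mod K\<^esub>"
      using x(2) quot.hom_one by simp
    finally have "K #> x = \<one>\<^bsub>G Mod K\<^esub>"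
      using Q.coprime_power_one[OF Q.subgroup_self _ quot.hom_closed[OF x(1)], of "card K"] assms(2)
      by (simp add: order_def)
    then have "x \<in> kernel G (G Mod K) (\<lambda>x. K #> x)"
      using x(1) by (simp add: kernel_def)
    then show ?thesis
      using kernel_Mod[OF assms(1)] by simp
  qed
  then show ?thesis
    using power_card_subgroup[OF K.subgroup_axioms] K.mem_carrier by blast
qed

text \<open>A normal Hall subgroup is determined by its order as a set of elements, hence is characteristic.\<close>

lemma (in group) normal_Hall_normal:
  assumes "R \<lhd> G" "K \<lhd> G\<lparr>carrier := R\<rparr>" "coprime (card K) (order (G\<lparr>carrier := R\<rparr> Mod K))"
  shows "K \<lhd> G"
proof -
  interpret R: normal R G by fact
  interpret RG: group "G\<lparr>carrier := R\<rparr>"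
    by (rule subgroup_imp_group[OF R.subgroup_axioms])
  have K: "subgroup K G" "K \<subseteq> R"
    using assms(2) unfolding normal_update_iff[OF R.subgroup_axioms] by auto
  have eq: "K = {x \<in> R. x [^] card K = \<one>}"
    using RG.normal_Hall_eq[OF assms(2,3)] by (simp add: update_pow[OF R.subgroup_axioms])
  have "g \<otimes> x \<otimes> inv g \<in> K" if g: "g \<in> carrier G" and x: "x \<in> K" for g x
  proof -
    have xR: "x \<in> R" "x [^] card K = \<one>"
      using x eq by blast+
    have "g \<otimes> x \<otimes> inv g \<in> R"
      by (rule R.inv_op_closed2[OF g xR(1)])
    moreover have "(g \<otimes> x \<otimes> inv g) [^] card K = \<one>"
      by (rule conj_pow[OF g R.mem_carrier[OF xR(1)] xR(2)])
    ultimately show ?thesis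
      using eq by blast
  qed
  then show ?thesis
    using K(1) normal_inv_iff by blast
qed

text \<open>A normal \<open>p\<close>-complement of the residual is a Hall subgroup and therefore normal in \<open>G\<close>. Conversely,
  the residual \<open>R\<close> lies in \<open>L\<close>, and \<open>D \<inter> R\<close> is its normal \<open>p\<close>-complement.\<close>

lemma (in group) NpUp_iff_above:
  assumes p: "Factorial_Ring.prime p" and fin: "finite (carrier G)"
  shows "NpUp p G \<longleftrightarrow> NpUp_above p G {\<one>}"
proof
  let ?R = "Up_residual p G"
  note R = Up_series_residual[OF p fin]
  note Rn = Up_series_normal(1)[OF R]
  note Rs = normal_imp_subgroup[OF Rn]
  assume "NpUp p G"
  then obtain K where K: "K \<lhd> G\<lparr>carrier := ?R\<rparr>" "\<not> p dvd card K"
    and "p_group p (G\<lparr>carrier := ?R\<rparr> Mod K)"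
    unfolding NpUp_def p_nilpotent_def p'_group_def by (auto simp: order_def)
  then obtain n where n: "order (G\<lparr>carrier := ?R\<rparr> Mod K) = p ^ n"
    unfolding p_group_def by blast
  have Ks: "subgroup K G" "K \<subseteq> ?R"
    using K(1) unfolding normal_update_iff[OF Rs] by auto
  have "coprime (card K) (p ^ n)"
    using K(2) p by (simp add: prime_imp_coprime coprime_commute)
  then have "K \<lhd> G"
    using normal_Hall_normal[OF Rn K(1)] n by simp
  moreover have "card ?R = p ^ n * card K"
    using order_Mod_update[OF Rs Ks] n by simp
  moreover have "card K = card K * card {\<one>}" "{\<one>} \<subseteq> K"
    using subgroup.one_closed[OF Ks(1)] by auto
  ultimately show "NpUp_above p G {\<one>}"
    unfolding NpUp_above_def using R Rn Ks(2) K(2) by blast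
next
  let ?R = "Up_residual p G"
  note Rn = Up_series_normal(1)[OF Up_series_residual[OF p fin]]
  note Rs = normal_imp_subgroup[OF Rn]
  assume "NpUp_above p G {\<one>}"
  then obtain D L d n where DL: "D \<lhd> G" "L \<lhd> G" "D \<subseteq> L" "Up_series p G L (carrier G)"
    and c: "card D = d * card {\<one>}" "\<not> p dvd d" "card L = p ^ n * card D"
    unfolding NpUp_above_def by blast
  have RL: "L \<inter> ?R = ?R"
    using Up_residual_subset[OF p fin DL(4)] by blast
  have Kn: "D \<inter> ?R \<lhd> G"
    by (rule normal_subgroup_intersect[OF DL(1) Rn])
  note Ks = normal_imp_subgroup[OF Kn]
  have Kr: "D \<inter> ?R \<lhd> G\<lparr>carrier := ?R\<rparr>"
    by (rule normal_restrict_supergroup[OF Rs Kn]) simp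
  obtain e where e: "card (L \<inter> ?R) = e * card (D \<inter> ?R)" "e dvd p ^ n"
    using index_Int[OF fin DL(1,2) Rn DL(3) c(3)] by blast
  obtain k where k: "e = p ^ k"
    using e(2) divides_primepow_nat[OF p] by blast
  have "order (G\<lparr>carrier := ?R\<rparr> Mod (D \<inter> ?R)) * card (D \<inter> ?R) = p ^ k * card (D \<inter> ?R)"
    using order_Mod_update[OF Rs Ks] e(1) RL k by simp
  then have "order (G\<lparr>carrier := ?R\<rparr> Mod (D \<inter> ?R)) = p ^ k"
    using card_subgroup_pos[OF Ks fin] by simp
  then have 1: "p_group p (G\<lparr>carrier := ?R\<rparr> Mod (D \<inter> ?R))"
    unfolding p_group_def using finite_group_factor[OF fin Rs Kn] by blast
  have "card (D \<inter> ?R) dvd d"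
    using card_subgroup_dvd[OF Ks normal_imp_subgroup[OF DL(1)]] c(1) by simp
  then have 2: "\<not> p dvd card (D \<inter> ?R)"
    using c(2) dvd_trans by blast
  have finH: "finite_group (G\<lparr>carrier := T\<rparr>)" if "subgroup T G" for T
    using subgroup_imp_group[OF that] finite_subset[OF subgroup.subset[OF that] fin]
    by (simp add: finite_group_def)
  have "p'_group p (G\<lparr>carrier := ?R\<rparr>\<lparr>carrier := D \<inter> ?R\<rparr>)"
    unfolding p'_group_def using finH[OF Ks] 2 by (simp add: order_def)
  then have "p_nilpotent p (G\<lparr>carrier := ?R\<rparr>)"
    unfolding p_nilpotent_def using finH[OF Rs] Kr 1 by blast
  then show "NpUp p G"
    unfolding NpUp_def finite_group_def using fin group_axioms by blast
qed

lemma (in finite_epi) NpUp_above_image: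
  assumes p: "Factorial_Ring.prime p" and Y: "Y \<lhd> G" "NpUp_above p G Y"
  shows "NpUp_above p H (h ` Y)"
proof -
  obtain D L d n where DL: "D \<lhd> G" "L \<lhd> G" "Y \<subseteq> D" "D \<subseteq> L" "Up_series p G L (carrier G)"
    and c: "card D = d * card Y" "\<not> p dvd d" "card L = p ^ n * card D"
    using Y(2) unfolding NpUp_above_def by blast
  obtain e where e: "card (h ` D) = e * card (h ` Y)" "e dvd d"
    using index_image[OF Y(1) DL(1,3) c(1)] by blast
  obtain f where f: "card (h ` L) = f * card (h ` D)" "f dvd p ^ n"
    using index_image[OF DL(1,2,4) c(3)] by blast
  obtain k where k: "f = p ^ k"
    using f(2) divides_primepow_nat[OF p] by blast
  have "\<not> p dvd e"
    using e(2) c(2) dvd_trans by blast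
  moreover have "Up_series p H (h ` L) (carrier H)"
    using Up_series_image[OF p DL(5)] surj by simp
  moreover have "h ` Y \<subseteq> h ` D" "h ` D \<subseteq> h ` L"
    using DL(3,4) by auto
  ultimately show ?thesis
    unfolding NpUp_above_def using normal_image[OF DL(1)] normal_image[OF DL(2)] e(1) f(1) k by blast
qed

lemma (in finite_epi) NpUp_above_vimage:
  assumes Y: "Y \<lhd> H" "NpUp_above p H Y"
  shows "NpUp_above p G (h -` Y \<inter> carrier G)"
proof -
  obtain D L d n where DL: "D \<lhd> H" "L \<lhd> H" "Y \<subseteq> D" "D \<subseteq> L" "Up_series p H L (carrier H)"
    and c: "card D = d * card Y" "\<not> p dvd d" "card L = p ^ n * card D"
    using Y(2) unfolding NpUp_above_def by blast
  have cv: "card (h -` N \<inter> carrier G) = card N * card (kernel G H h)" if "N \<lhd> H" for N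
    by (rule card_vimage_kernel[OF normal_imp_subgroup[OF that]])
  have "card (h -` D \<inter> carrier G) = d * card (h -` Y \<inter> carrier G)"
    "card (h -` L \<inter> carrier G) = p ^ n * card (h -` D \<inter> carrier G)"
    using cv[OF DL(1)] cv[OF DL(2)] cv[OF Y(1)] c by simp_all
  moreover have "h -` carrier H \<inter> carrier G = carrier G"
    by auto
  then have "Up_series p G (h -` L \<inter> carrier G) (carrier G)"
    using Up_series_vimage[OF DL(5)] by simp
  moreover have "h -` Y \<inter> carrier G \<subseteq> h -` D \<inter> carrier G" "h -` D \<inter> carrier G \<subseteq> h -` L \<inter> carrier G"
    using DL(3,4) by auto
  ultimately show ?thesis
    unfolding NpUp_above_def using normal_vimage[OF DL(1)] normal_vimage[OF DL(2)] c(2) by blast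
qed

section \<open>The norm\<close>

lemma (in group) mem_normalizer_iff:
  assumes "S \<subseteq> carrier G"
  shows "g \<in> normalizer G S \<longleftrightarrow> g \<in> carrier G \<and> (\<lambda>x. g \<otimes> x \<otimes> inv g) ` S = S"
proof -
  have "g <# S #> inv g = (\<lambda>x. g \<otimes> x \<otimes> inv g) ` S"
    unfolding l_coset_def r_coset_def by auto
  then show ?thesis
    using assms unfolding normalizer_def stabilizer_def by auto
qed

lemma (in group) conj_finite_epi:
  assumes "finite (carrier G)" "subgroup T G" "g \<in> carrier G"
  shows "finite_epi (G\<lparr>carrier := T\<rparr>) (G\<lparr>carrier := (\<lambda>x. g \<otimes> x \<otimes> inv g) ` T\<rparr>) (\<lambda>x. g \<otimes> x \<otimes> inv g)"
proof -
  have "(\<lambda>x. g \<otimes> x \<otimes> inv g) \<in> hom G G"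
    using assms(3) by (intro homI) (simp_all add: m_assoc inv_mult_cancel)
  then interpret c: group_hom G G "\<lambda>x. g \<otimes> x \<otimes> inv g"
    by unfold_locales
  have "finite T"
    using assms(1) subgroup.subset[OF assms(2)] finite_subset by blast
  then show ?thesis
    using c.induced_group_hom[OF assms(2)]
    unfolding finite_epi_def finite_epi_axioms_def by simp
qed

lemma (in group) Up_residual_subgroup:
  assumes p: "Factorial_Ring.prime p" and fin: "finite (carrier G)" and T: "subgroup T G"
  shows "Up_series p (G\<lparr>carrier := T\<rparr>) (Up_residual p (G\<lparr>carrier := T\<rparr>)) T"
    "Up_residual p (G\<lparr>carrier := T\<rparr>) \<lhd> G\<lparr>carrier := T\<rparr>"
    "subgroup (Up_residual p (G\<lparr>carrier := T\<rparr>)) G" "Up_residual p (G\<lparr>carrier := T\<rparr>) \<subseteq> T"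
proof -
  interpret T: group "G\<lparr>carrier := T\<rparr>"
    by (rule subgroup_imp_group[OF T])
  have "finite T"
    using fin subgroup.subset[OF T] finite_subset by blast
  then show s: "Up_series p (G\<lparr>carrier := T\<rparr>) (Up_residual p (G\<lparr>carrier := T\<rparr>)) T"
    using T.Up_series_residual[OF p] by simp
  show n: "Up_residual p (G\<lparr>carrier := T\<rparr>) \<lhd> G\<lparr>carrier := T\<rparr>"
    by (rule Up_series_normal(1)[OF s])
  show "subgroup (Up_residual p (G\<lparr>carrier := T\<rparr>)) G" "Up_residual p (G\<lparr>carrier := T\<rparr>) \<subseteq> T"
    using n unfolding normal_update_iff[OF T] by auto
qed

text \<open>One inclusion is the behaviour of residuals under the epimorphism ``conjugation by \<open>g\<close>''; the other is
  the same for its inverse.\<close>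

lemma (in group) Up_residual_conj:
  assumes p: "Factorial_Ring.prime p" and fin: "finite (carrier G)"
    and T: "subgroup T G" and g: "g \<in> carrier G"
  shows "(\<lambda>x. g \<otimes> x \<otimes> inv g) ` Up_residual p (G\<lparr>carrier := T\<rparr>) =
    Up_residual p (G\<lparr>carrier := (\<lambda>x. g \<otimes> x \<otimes> inv g) ` T\<rparr>)"
proof -
  let ?c = "\<lambda>g x. g \<otimes> x \<otimes> inv g"
  have cc: "?c g (?c (inv g) x) = x" "?c (inv g) (?c g x) = x" if "x \<in> carrier G" for x
    using g that by (simp_all add: m_assoc inv_mult_cancel)
  interpret a: finite_epi "G\<lparr>carrier := T\<rparr>" "G\<lparr>carrier := ?c g ` T\<rparr>" "?c g"
    by (rule conj_finite_epi[OF fin T g])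
  have "group_hom G G (?c g)"
    using g by unfold_locales (intro homI, simp_all add: m_assoc inv_mult_cancel)
  then have T': "subgroup (?c g ` T) G"
    using group_hom.subgroup_img_is_subgroup[OF _ T] by blast
  interpret b: finite_epi "G\<lparr>carrier := ?c g ` T\<rparr>" "G\<lparr>carrier := ?c (inv g) ` ?c g ` T\<rparr>" "?c (inv g)"
    by (rule conj_finite_epi[OF fin T' inv_closed[OF g]])
  have cT: "?c (inv g) ` ?c g ` T = T"
    using cc(2) subgroup.mem_carrier[OF T] by (force simp: image_image)
  have Rc: "Up_residual p (G\<lparr>carrier := ?c g ` T\<rparr>) \<subseteq> carrier G"
    by (rule subgroup.subset[OF Up_residual_subgroup(3)[OF p fin T']])
  have "Up_residual p (G\<lparr>carrier := ?c g ` T\<rparr>) \<subseteq> ?c g ` Up_residual p (G\<lparr>carrier := T\<rparr>)"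
  proof
    fix y assume y: "y \<in> Up_residual p (G\<lparr>carrier := ?c g ` T\<rparr>)"
    then have "?c (inv g) y \<in> Up_residual p (G\<lparr>carrier := T\<rparr>)"
      using b.Up_residual_image[OF p] unfolding cT by blast
    then have "?c g (?c (inv g) y) \<in> ?c g ` Up_residual p (G\<lparr>carrier := T\<rparr>)"
      by (rule imageI)
    moreover have "?c g (?c (inv g) y) = y"
      using cc(1) Rc y by blast
    ultimately show "y \<in> ?c g ` Up_residual p (G\<lparr>carrier := T\<rparr>)"
      by simp
  qed
  then show ?thesis
    using a.Up_residual_image[OF p] by blast
qed

lemma (in group) mem_Up_norm_iff:
  assumes "Factorial_Ring.prime p" "finite (carrier G)"
  shows "x \<in> Up_norm p G \<longleftrightarrow> x \<in> carrier G \<and> (\<forall>T. subgroup T G \<longrightarrow>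
    (\<lambda>y. x \<otimes> y \<otimes> inv x) ` Up_residual p (G\<lparr>carrier := T\<rparr>) = Up_residual p (G\<lparr>carrier := T\<rparr>))"
proof -
  have "x \<in> normalizer G (Up_residual p (G\<lparr>carrier := T\<rparr>)) \<longleftrightarrow> x \<in> carrier G \<and>
      (\<lambda>y. x \<otimes> y \<otimes> inv x) ` Up_residual p (G\<lparr>carrier := T\<rparr>) = Up_residual p (G\<lparr>carrier := T\<rparr>)"
    if "subgroup T G" for T
    by (rule mem_normalizer_iff[OF subgroup.subset[OF Up_residual_subgroup(3)[OF assms that]]])
  then show ?thesis
    unfolding Up_norm_def using subgroup_self by blast
qed

text \<open>If \<open>x\<close> is in the norm, then \<open>x\<close> normalizes the residual of the conjugate of \<open>T\<close> by $g^{-1}$;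
  conjugating back, $gxg^{-1}$ normalizes the residual of \<open>T\<close>.\<close>

lemma (in group) Up_norm_normal:
  assumes p: "Factorial_Ring.prime p" and fin: "finite (carrier G)"
  shows "Up_norm p G \<lhd> G"
proof -
  let ?c = "\<lambda>g x. g \<otimes> x \<otimes> inv g"
  let ?U = "\<lambda>T. Up_residual p (G\<lparr>carrier := T\<rparr>)"
  have "subgroup (Up_norm p G) G"
    unfolding Up_norm_def
  proof (rule subgroups_Inter)
    fix N assume "N \<in> (\<lambda>T. normalizer G (?U T)) ` {T. subgroup T G}"
    then obtain T where "subgroup T G" "N = normalizer G (?U T)"
      by blast
    then show "subgroup N G"
      using normalizer_imp_subgroup subgroup.subset[OF Up_residual_subgroup(3)[OF p fin]] by blast
  qed (use subgroup_self in blast)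
  moreover have "?c g x \<in> Up_norm p G" if g: "g \<in> carrier G" and x: "x \<in> Up_norm p G" for g x
  proof -
    have xG: "x \<in> carrier G"
      using x unfolding mem_Up_norm_iff[OF p fin] by blast
    have "?c (?c g x) ` ?U T = ?U T" if T: "subgroup T G" for T
    proof -
      let ?T = "?c (inv g) ` T"
      have "group_hom G G (?c (inv g))"
        using g by unfold_locales (intro homI, simp_all add: m_assoc inv_mult_cancel)
      then have T': "subgroup ?T G"
        using group_hom.subgroup_img_is_subgroup[OF _ T] by blast
      have cT: "?c g ` ?T = T"
        using subgroup.mem_carrier[OF T] g by (force simp: image_image m_assoc inv_mult_cancel)
      have Uc: "?U T \<subseteq> carrier G"
        by (rule subgroup.subset[OF Up_residual_subgroup(3)[OF p fin T]])
      have "?c (?c g x) ` ?U T = ?c g ` ?c x ` ?c (inv g) ` ?U T"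
        unfolding image_image
        by (rule image_cong) (use g xG Uc in \<open>auto simp: m_assoc inv_mult_group subset_iff\<close>)
      also have "?c (inv g) ` ?U T = ?U ?T"
        by (rule Up_residual_conj[OF p fin T inv_closed[OF g]])
      also have "?c x ` ?U ?T = ?U ?T"
        using x T' unfolding mem_Up_norm_iff[OF p fin] by blast
      also have "?c g ` ?U ?T = ?U T"
        using Up_residual_conj[OF p fin T' g] unfolding cT .
      finally show ?thesis .
    qed
    then show ?thesis
      unfolding mem_Up_norm_iff[OF p fin] using g xG by simp
  qed
  ultimately show ?thesis
    unfolding normal_inv_iff by blast
qed

section \<open>Minimal normal \<open>p\<close>-subgroups\<close>

lemma (in group) conj_fixed_imp_commute:
  assumes "x \<in> carrier G" "z \<in> carrier G" "x \<otimes> z \<otimes> inv x = z"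
  shows "x \<otimes> z = z \<otimes> x"
proof -
  have "x \<otimes> z \<otimes> inv x \<otimes> x = z \<otimes> x"
    using assms(3) by simp
  then show ?thesis
    using assms(1,2) by (simp add: m_assoc)
qed

text \<open>Class equation: if the center were trivial, every class but that of the identity would have
  length divisible by \<open>p\<close>.\<close>

lemma (in group) p_group_center_nontrivial:
  assumes p: "Factorial_Ring.prime p" and ord: "order G = p ^ k" and k: "k > 0"
  shows "\<exists>z\<in>carrier G. z \<noteq> \<one> \<and> (\<forall>x\<in>carrier G. x \<otimes> z = z \<otimes> x)"
proof (rule ccontr)
  assume triv: "\<not> ?thesis"
  let ?\<phi> = "\<lambda>g. \<lambda>h \<in> carrier G. g \<otimes> h \<otimes> inv g"
  interpret act: group_action G "carrier G" ?\<phi>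
    by (rule action_by_conjugation)
  have pos: "p > 0" using p prime_gt_0_nat by blast
  then have fin: "finite (carrier G)"
    using ord order_gt_0_iff_finite by simp
  have fx: "p dvd card (orbit G ?\<phi> z)" if z: "z \<in> carrier G" "z \<noteq> \<one>" for z
  proof -
    have "card (orbit G ?\<phi> z) * card (stabilizer G ?\<phi> z) = p ^ k"
      unfolding act.orbit_stabilizer_theorem[OF z(1)] by (rule ord)
    then have "card (orbit G ?\<phi> z) dvd p ^ k"
      by (rule dvdI[OF sym])
    then obtain i where i: "card (orbit G ?\<phi> z) = p ^ i"
      using divides_primepow_nat[OF p] by blast
    have "i \<noteq> 0"
    proof
      assume "i = 0"
      then have "card (orbit G ?\<phi> z) = 1"
        using i by simp
      then obtain y where y: "orbit G ?\<phi> z = {y}"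
        by (rule card_1_singletonE)
      have o: "x \<otimes> z \<otimes> inv x = y" if x: "x \<in> carrier G" for x
      proof -
        have "?\<phi> x z \<in> orbit G ?\<phi> z"
          unfolding orbit_def using x by blast
        then show ?thesis
          using y z(1) by simp
      qed
      have yz: "y = z"
        using o[OF one_closed] z(1) by simp
      have "x \<otimes> z = z \<otimes> x" if x: "x \<in> carrier G" for x
        by (rule conj_fixed_imp_commute[OF x z(1) o[OF x, unfolded yz]])
      then show False
        using triv z by blast
    qed
    then show ?thesis using i by simp
  qed
  have o1: "orbit G ?\<phi> \<one> = {\<one>}"
    unfolding orbit_def by (auto intro!: exI[of _ \<one>])
  have finO: "finite (orbits G (carrier G) ?\<phi>)"
    unfolding orbits_def using fin by simp
  have "card (carrier G) = (\<Sum>C\<in>orbits G (carrier G) ?\<phi>. card C)"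
    using act.disjoint_sum[OF fin, of "\<lambda>_. 1::nat"] by simp
  also have "\<dots> = card {\<one>} + (\<Sum>C\<in>orbits G (carrier G) ?\<phi> - {{\<one>}}. card C)"
    using o1 one_closed by (intro sum.remove[OF finO]) (auto simp: orbits_def)
  finally have s: "p ^ k = 1 + (\<Sum>C\<in>orbits G (carrier G) ?\<phi> - {{\<one>}}. card C)"
    using ord by (simp add: order_def)
  have "p dvd (\<Sum>C\<in>orbits G (carrier G) ?\<phi> - {{\<one>}}. card C)"
  proof (rule dvd_sum)
    fix C assume "C \<in> orbits G (carrier G) ?\<phi> - {{\<one>}}"
    then obtain z where "z \<in> carrier G" "C = orbit G ?\<phi> z" "C \<noteq> {\<one>}"
      unfolding orbits_def by auto
    then show "p dvd card C"
      using fx o1 by blast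
  qed
  moreover have "p dvd p ^ k"
    using k by simp
  ultimately have "p dvd 1"
    unfolding s using dvd_add_left_iff by blast
  then show False
    using p not_prime_unit by blast
qed

text \<open>The center of \<open>M\<close> is characteristic in \<open>M\<close>, hence normal in \<open>G\<close>, and it is not trivial.\<close>

lemma (in group) minimal_normal_p_subgroup_abelian:
  assumes p: "Factorial_Ring.prime p" and M: "M \<lhd> G" and c: "card M = p ^ k" and k: "k > 0"
    and min: "\<And>V. V \<lhd> G \<Longrightarrow> V \<subseteq> M \<Longrightarrow> V = {\<one>} \<or> V = M"
    and xy: "x \<in> M" "y \<in> M"
  shows "x \<otimes> y = y \<otimes> x"
proof -
  interpret M: normal M G by fact
  interpret MG: group "G\<lparr>carrier := M\<rparr>"
    by (rule subgroup_imp_group[OF M.subgroup_axioms])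
  \<comment> \<open>The center of \<open>M\<close>.\<close>
  define Z where "Z = {z \<in> M. \<forall>x\<in>M. x \<otimes> z = z \<otimes> x}"
  obtain z where z: "z \<in> Z" "z \<noteq> \<one>"
    using MG.p_group_center_nontrivial[OF p _ k] c by (auto simp: order_def Z_def)
  have "subgroup Z G"
  proof (rule subgroupI)
    show "Z \<subseteq> carrier G" "Z \<noteq> {}"
      using M.subset z by (auto simp: Z_def)
    show "inv z \<in> Z" if "z \<in> Z" for z
    proof -
      have "x \<otimes> inv z = inv z \<otimes> x" if x: "x \<in> M" for x
      proof -
        have c: "x \<in> carrier G" "z \<in> carrier G" "x \<otimes> z = z \<otimes> x"
          using \<open>z \<in> Z\<close> x M.mem_carrier unfolding Z_def by blast+
        have "inv z \<otimes> (x \<otimes> z) \<otimes> inv z = inv z \<otimes> (z \<otimes> x) \<otimes> inv z"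
          using c(3) by simp
        then show ?thesis
          using c(1,2) by (simp add: m_assoc inv_mult_cancel)
      qed
      moreover have "inv z \<in> M"
        using that unfolding Z_def by blast
      ultimately show ?thesis
        unfolding Z_def by blast
    qed
    show "z \<otimes> w \<in> Z" if "z \<in> Z" "w \<in> Z" for z w
    proof -
      have "x \<otimes> (z \<otimes> w) = z \<otimes> w \<otimes> x" if x: "x \<in> M" for x
      proof -
        have c: "x \<in> carrier G" "z \<in> carrier G" "w \<in> carrier G" "x \<otimes> z = z \<otimes> x" "x \<otimes> w = w \<otimes> x"
          using \<open>z \<in> Z\<close> \<open>w \<in> Z\<close> x M.mem_carrier unfolding Z_def by blast+
        have "x \<otimes> (z \<otimes> w) = z \<otimes> (x \<otimes> w)"
          using c(1-4) by (simp flip: m_assoc)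
        then show ?thesis
          using c by (simp add: m_assoc)
      qed
      moreover have "z \<otimes> w \<in> M"
        using that unfolding Z_def by blast
      ultimately show ?thesis
        unfolding Z_def by blast
    qed
  qed
  moreover have "g \<otimes> z \<otimes> inv g \<in> Z" if g: "g \<in> carrier G" and z: "z \<in> Z" for g z
  proof -
    have zM: "z \<in> M" "z \<in> carrier G"
      using z M.mem_carrier unfolding Z_def by blast+
    have "x \<otimes> (g \<otimes> z \<otimes> inv g) = g \<otimes> z \<otimes> inv g \<otimes> x" if x: "x \<in> M" for x
    proof -
      have xc: "x \<in> carrier G" using x by simp
      have "(inv g \<otimes> x \<otimes> g) \<otimes> z = z \<otimes> (inv g \<otimes> x \<otimes> g)"
        using M.inv_op_closed1[OF g x] z unfolding Z_def by blast
      then have "g \<otimes> ((inv g \<otimes> x \<otimes> g) \<otimes> z) \<otimes> inv g = g \<otimes> (z \<otimes> (inv g \<otimes> x \<otimes> g)) \<otimes> inv g"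
        by simp
      then show ?thesis
        using g xc zM by (simp add: m_assoc inv_mult_cancel)
    qed
    then show ?thesis
      using M.inv_op_closed2[OF g zM(1)] unfolding Z_def by blast
  qed
  ultimately have "Z \<lhd> G"
    unfolding normal_inv_iff by blast
  moreover have "Z \<subseteq> M"
    unfolding Z_def by blast
  ultimately have "Z = M"
    using min[of Z] z by blast
  then show ?thesis
    using xy unfolding Z_def by blast
qed

section \<open>Descent inside the norm\<close>

text \<open>Modulo \<open>W\<close>, the central \<open>p\<close>-subgroup \<open>V\<close> splits off from \<open>D\<close> with a normal \<open>p'\<close>-complement
  \<open>E\<close>. Replacing \<open>D\<close> by \<open>E\<close> moves the factor \<open>|V:W|\<close> from below \<open>D\<close> to the \<open>p\<close>-part above it.\<close>

lemma (in group) NpUp_above_central_step: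
  assumes p: "Factorial_Ring.prime p" and fin: "finite (carrier G)"
    and W: "W \<lhd> G" "W \<subseteq> V" and V: "V \<lhd> G" "card V = p ^ k * card W"
    and DL: "D \<lhd> G" "L \<lhd> G" "V \<subseteq> D" "D \<subseteq> L" "Up_series p G L (carrier G)"
    and c: "card D = d * card V" "\<not> p dvd d" "card L = p ^ n * card D"
    and ab: "\<And>x y. x \<in> V \<Longrightarrow> y \<in> V \<Longrightarrow> W #> (x \<otimes> y) = W #> (y \<otimes> x)"
    and central: "\<And>x y. x \<in> D \<Longrightarrow> y \<in> V \<Longrightarrow> W #> (x \<otimes> y) = W #> (y \<otimes> x)"
  shows "NpUp_above p G W"
proof -
  let ?\<pi> = "\<lambda>x. W #> x"
  interpret quot: finite_epi G "G Mod W" ?\<pi>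
    by (rule finite_epi_Mod[OF W(1) fin])
  note ker = kernel_Mod[OF W(1)]
  note Ws = normal_imp_subgroup[OF W(1)] and Vs = normal_imp_subgroup[OF V(1)]
    and Ds = normal_imp_subgroup[OF DL(1)]
  have Wpos: "card W > 0"
    by (rule card_subgroup_pos[OF Ws fin])
  have Vc: "x \<in> carrier G" if "x \<in> V" for x
    using subgroup.mem_carrier[OF Vs that] .
  have Dc: "x \<in> carrier G" if "x \<in> D" for x
    using subgroup.mem_carrier[OF Ds that] .
  have comm: "?\<pi> x \<otimes>\<^bsub>G Mod W\<^esub> ?\<pi> y = ?\<pi> y \<otimes>\<^bsub>G Mod W\<^esub> ?\<pi> x"
    if "x \<in> carrier G" "y \<in> carrier G" "?\<pi> (x \<otimes> y) = ?\<pi> (y \<otimes> x)" for x y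
    using quot.hom_mult[OF that(1,2)] quot.hom_mult[OF that(2,1)] that(3) by metis
  have "card (?\<pi> ` V) * card (V \<inter> W) = card V"
    using quot.card_image_kernel[OF Vs] unfolding ker .
  moreover have "V \<inter> W = W"
    using W(2) by blast
  ultimately have cM: "card (?\<pi> ` V) = p ^ k"
    using V(2) Wpos by simp
  have "card (?\<pi> ` D) * card (D \<inter> W) = card D"
    using quot.card_image_kernel[OF Ds] unfolding ker .
  moreover have "D \<inter> W = W"
    using W(2) DL(3) by blast
  ultimately have "card (?\<pi> ` D) * card W = (d * card (?\<pi> ` V)) * card W"
    using c(1) V(2) cM by (simp add: mult.assoc)
  then have cK: "card (?\<pi> ` D) = d * card (?\<pi> ` V)"
    using Wpos by simp
  have abM: "x \<otimes>\<^bsub>G Mod W\<^esub> y = y \<otimes>\<^bsub>G Mod W\<^esub> x" if xy: "x \<in> ?\<pi> ` V" "y \<in> ?\<pi> ` V" for x y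
  proof -
    obtain v w where "v \<in> V" "w \<in> V" "x = ?\<pi> v" "y = ?\<pi> w"
      using xy by blast
    then show ?thesis
      using comm[OF Vc Vc ab] by metis
  qed
  have "?\<pi> ` V \<subseteq> ?\<pi> ` D"
    using DL(3) by (rule image_mono)
  then interpret sec: abelian_normal_section "G Mod W" "?\<pi> ` V" "?\<pi> ` D"
    using quot.normal_image[OF V(1)] quot.normal_image[OF DL(1)] quot.fin_img quot.H.group_axioms abM
    unfolding abelian_normal_section_def abelian_normal_section_axioms_def by blast
  have cop: "coprime d (card (?\<pi> ` V))"
    unfolding cM using prime_imp_coprime[OF p c(2)] by (simp add: coprime_commute)
  have "x \<otimes>\<^bsub>G Mod W\<^esub> y = y \<otimes>\<^bsub>G Mod W\<^esub> x" if xy: "x \<in> ?\<pi> ` D" "y \<in> ?\<pi> ` V" for x y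
  proof -
    obtain v w where "v \<in> D" "w \<in> V" "x = ?\<pi> v" "y = ?\<pi> w"
      using xy by blast
    then show ?thesis
      using comm[OF Dc Vc central] by metis
  qed
  then obtain E where E: "E \<lhd> G Mod W" "E \<subseteq> ?\<pi> ` D" "card E = d"
    using sec.central_complement[OF _ cK cop] by blast
  let ?E = "?\<pi> -` E \<inter> carrier G"
  have En: "?E \<lhd> G"
    by (rule quot.normal_vimage[OF E(1)])
  have "?E \<subseteq> ?\<pi> -` (?\<pi> ` D) \<inter> carrier G"
    by (rule Int_mono[OF vimage_mono[OF E(2)] order_refl])
  also have "\<dots> = D"
    using quot.vimage_image[OF Ds] order_trans[OF W(2) DL(3)] unfolding ker .
  finally have ED: "?E \<subseteq> L"
    using DL(4) by blast
  have cE: "card ?E = d * card W"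
    using quot.card_vimage_kernel[OF normal_imp_subgroup[OF E(1)]] E(3) unfolding ker by simp
  have "\<one>\<^bsub>G Mod W\<^esub> \<in> E"
    by (rule subgroup.one_closed[OF normal_imp_subgroup[OF E(1)]])
  then have WE: "W \<subseteq> ?E"
    using quot.kernel_eq_vimage unfolding ker by blast
  have "card L = p ^ (n + k) * card ?E"
    unfolding c(3) c(1) V(2) cE power_add by (simp only: mult_ac)
  then show ?thesis
    unfolding NpUp_above_def using En DL(2) WE ED DL(5) cE c(2) by blast
qed

text \<open>The place where the norm is used, for the single subgroup \<open>H\<close>. Let \<open>S\<close> be its residual. Commutators of
  \<open>S\<close> with \<open>V\<close> lie in \<open>V\<close>, as \<open>V\<close> is normal, and in \<open>S\<close>, as \<open>V\<close> normalizes \<open>S\<close>;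
  so they lie in \<open>W\<close>. The witness for \<open>N\<close> is \<open>VS\<close>, and the series of \<open>H\<close> above \<open>S\<close> is
  carried to \<open>G/V\<close> along the epimorphism \<open>H \<rightarrow> G/V\<close> and then pulled back to \<open>G\<close>.\<close>

lemma (in group) NpUp_above_supplement_step:
  assumes p: "Factorial_Ring.prime p" and fin: "finite (carrier G)"
    and W: "W \<lhd> G" and V: "V \<lhd> G" "V \<subseteq> Up_norm p G"
    and H: "subgroup H G" "H \<inter> V \<subseteq> W" "\<And>g. g \<in> carrier G \<Longrightarrow> \<exists>v\<in>V. v \<otimes> g \<in> H"
  shows "\<exists>N. V \<subseteq> N \<and> Up_series p G N (carrier G) \<and>
    (\<forall>x\<in>N. \<exists>v\<in>V. \<exists>s. x = v \<otimes> s \<and> s \<in> carrier G \<and> (\<forall>y\<in>V. W #> (s \<otimes> y) = W #> (y \<otimes> s)))"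
proof -
  interpret V: normal V G by fact
  let ?S = "Up_residual p (G\<lparr>carrier := H\<rparr>)"
  note S = Up_residual_subgroup[OF p fin H(1)]
  have Sc: "s \<in> carrier G" if "s \<in> ?S" for s
    by (rule subgroup.mem_carrier[OF S(3) that])
  have SH: "h \<otimes> s \<otimes> inv h \<in> ?S" if "h \<in> H" "s \<in> ?S" for h s
    using S(2) that unfolding normal_update_iff[OF H(1)] by blast
  have SV: "v \<otimes> s \<otimes> inv v \<in> ?S" if "v \<in> V" "s \<in> ?S" for v s
    using V(2) that H(1) unfolding subset_iff mem_Up_norm_iff[OF p fin] by blast
  have comm: "W #> (s \<otimes> y) = W #> (y \<otimes> s)" if s: "s \<in> ?S" and y: "y \<in> V" for s y
  proof -
    have c: "s \<in> carrier G" "y \<in> carrier G"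
      using Sc[OF s] y by auto
    \<comment> \<open>The commutator of \<open>s\<close> and \<open>y\<close>, bracketed so as to lie in \<open>S\<close> and then in \<open>V\<close>.\<close>
    have "s \<otimes> (y \<otimes> inv s \<otimes> inv y) \<in> ?S"
      using subgroup.m_closed[OF S(3) s SV[OF y subgroup.m_inv_closed[OF S(3) s]]] .
    moreover have "(s \<otimes> y \<otimes> inv s) \<otimes> inv y \<in> V"
      using V.m_closed[OF V.inv_op_closed2[OF c(1) y] V.m_inv_closed[OF y]] .
    ultimately have w: "s \<otimes> y \<otimes> inv s \<otimes> inv y \<in> W"
      using S(4) H(2) c by (auto simp: m_assoc)
    have "s \<otimes> y = (s \<otimes> y \<otimes> inv s \<otimes> inv y) \<otimes> (y \<otimes> s)"
      using c by (simp add: m_assoc inv_mult_cancel)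
    then have "s \<otimes> y \<in> W #> (y \<otimes> s)"
      using w unfolding r_coset_def by blast
    then show ?thesis
      using repr_independence[OF _ _ normal_imp_subgroup[OF W]] c by blast
  qed
  let ?\<pi> = "\<lambda>x. V #> x"
  interpret quot: finite_epi G "G Mod V" ?\<pi>
    by (rule finite_epi_Mod[OF V(1) fin])
  have Hc: "H \<subseteq> carrier G"
    by (rule subgroup.subset[OF H(1)])
  have "?\<pi> ` H = carrier (G Mod V)"
  proof
    show "?\<pi> ` H \<subseteq> carrier (G Mod V)"
      using Hc quot.hom_closed by blast
    show "carrier (G Mod V) \<subseteq> ?\<pi> ` H"
    proof
      fix c assume "c \<in> carrier (G Mod V)"
      then obtain g where g: "g \<in> carrier G" "c = V #> g"
        unfolding quot.surj[symmetric] by blast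
      obtain v where v: "v \<in> V" "v \<otimes> g \<in> H"
        using H(3)[OF g(1)] by blast
      have "v \<otimes> g \<in> V #> g"
        using v(1) unfolding r_coset_def by blast
      then have "V #> g = V #> (v \<otimes> g)"
        using repr_independence[OF _ g(1) V.subgroup_axioms] by blast
      then show "c \<in> ?\<pi> ` H"
        using v(2) g(2) by blast
    qed
  qed
  moreover have "finite H"
    using Hc fin finite_subset by blast
  ultimately interpret res: finite_epi "G\<lparr>carrier := H\<rparr>" "G Mod V" ?\<pi>
    using quot.induced_group_hom'[OF H(1)]
    by (simp add: finite_epi_def finite_epi_axioms_def)
  let ?N = "?\<pi> -` (?\<pi> ` ?S) \<inter> carrier G"
  have "Up_series p (G Mod V) (?\<pi> ` ?S) (carrier (G Mod V))"
    using res.Up_series_image[OF p S(1)] res.surj by simp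
  moreover have "?\<pi> -` carrier (G Mod V) \<inter> carrier G = carrier G"
    using quot.hom_closed by blast
  ultimately have 1: "Up_series p G ?N (carrier G)"
    using quot.Up_series_vimage[of p "?\<pi> ` ?S" "carrier (G Mod V)"] by simp
  have 2: "V \<subseteq> ?N"
  proof
    fix v assume v: "v \<in> V"
    have "V #> v = V #> \<one>"
      using V.rcos_const[OF group_axioms v] by simp
    then have "V #> v \<in> ?\<pi> ` ?S"
      using subgroup.one_closed[OF S(3)] by (rule image_eqI)
    then show "v \<in> ?N"
      using V.mem_carrier[OF v] by (simp only: Int_iff vimage_eq)
  qed
  have 3: "\<exists>v\<in>V. \<exists>s. x = v \<otimes> s \<and> s \<in> carrier G \<and> (\<forall>y\<in>V. W #> (s \<otimes> y) = W #> (y \<otimes> s))"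
    if x: "x \<in> ?N" for x
  proof -
    obtain v s where vs: "v \<in> V" "s \<in> ?S" "x = v \<otimes> s"
      using vimage_Mod[OF V.subgroup_axioms _ S(3), of x] x by blast
    then show ?thesis
      using comm Sc by blast
  qed
  show ?thesis
    by (intro exI[of _ ?N] conjI ballI 1 2 3)
qed

lemma (in group) fixed_points_normal:
  assumes M: "M \<lhd> G" and K: "K \<lhd> G"
  shows "{y \<in> M. \<forall>k\<in>K. k \<otimes> y \<otimes> inv k = y} \<lhd> G" (is "?C \<lhd> G")
proof -
  interpret M: normal M G by fact
  interpret K: normal K G by fact
  have Cc: "y \<in> carrier G" if "y \<in> ?C" for y
    using that by auto
  have "subgroup ?C G"
  proof (rule subgroupI)
    show "?C \<subseteq> carrier G"
      by auto
    have "\<one> \<in> ?C"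
      by (auto simp: M.one_closed)
    then show "?C \<noteq> {}"
      by blast
    show "inv y \<in> ?C" if y: "y \<in> ?C" for y
    proof -
      have "k \<otimes> inv y \<otimes> inv k = inv y" if k: "k \<in> K" for k
      proof -
        have "inv (k \<otimes> y \<otimes> inv k) = inv y"
          using y k by simp
        then show ?thesis
          using K.mem_carrier[OF k] Cc[OF y] by (simp add: inv_mult_group m_assoc)
      qed
      then show ?thesis
        using y by simp
    qed
    show "y \<otimes> z \<in> ?C" if y: "y \<in> ?C" and z: "z \<in> ?C" for y z
    proof -
      have "k \<otimes> (y \<otimes> z) \<otimes> inv k = y \<otimes> z" if k: "k \<in> K" for k
      proof -
        have "k \<otimes> (y \<otimes> z) \<otimes> inv k = (k \<otimes> y \<otimes> inv k) \<otimes> (k \<otimes> z \<otimes> inv k)"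
          using K.mem_carrier[OF k] Cc[OF y] Cc[OF z] by (simp add: m_assoc inv_mult_cancel)
        also have "\<dots> = y \<otimes> z"
          using y z k by simp
        finally show ?thesis .
      qed
      then show ?thesis
        using y z by simp
    qed
  qed
  moreover have "g \<otimes> y \<otimes> inv g \<in> ?C" if g: "g \<in> carrier G" and y: "y \<in> ?C" for g y
  proof -
    have "k \<otimes> (g \<otimes> y \<otimes> inv g) \<otimes> inv k = g \<otimes> y \<otimes> inv g" if k: "k \<in> K" for k
    proof -
      have "k \<otimes> (g \<otimes> y \<otimes> inv g) \<otimes> inv k =
          g \<otimes> ((inv g \<otimes> k \<otimes> g) \<otimes> y \<otimes> inv (inv g \<otimes> k \<otimes> g)) \<otimes> inv g"
        using g K.mem_carrier[OF k] Cc[OF y] by (simp add: m_assoc inv_mult_group inv_mult_cancel)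
      also have "(inv g \<otimes> k \<otimes> g) \<otimes> y \<otimes> inv (inv g \<otimes> k \<otimes> g) = y"
        using K.inv_op_closed1[OF g k] y by blast
      finally show ?thesis .
    qed
    moreover have "g \<otimes> y \<otimes> inv g \<in> M"
      using M.inv_op_closed2[OF g] y by blast
    ultimately show ?thesis
      by blast
  qed
  ultimately show ?thesis
    unfolding normal_inv_iff by blast
qed

text \<open>\<open>W\<close> is a maximal normal subgroup of \<open>G\<close> properly inside \<open>V\<close>, so that \<open>V/W\<close> is a chief factor and
  the minimality of \<open>V/W\<close> decides between the two kinds of action of \<open>D\<close> on it.\<close>

lemma (in group) NpUp_above_descend:
  assumes p: "Factorial_Ring.prime p" and fin: "finite (carrier G)" and sol: "p_solvable p G"
    and V: "V \<lhd> G" "V \<subseteq> Up_norm p G" "V \<noteq> {\<one>}" and above: "NpUp_above p G V"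
  shows "\<exists>W. W \<lhd> G \<and> W \<subset> V \<and> NpUp_above p G W"
proof -
  interpret V: normal V G by fact
  let ?T = "{W. W \<lhd> G \<and> W \<subset> V}"
  have "?T \<subseteq> Pow (carrier G)"
    using V.subset by blast
  then have finT: "finite ?T"
    using fin finite_subset by blast
  have "{\<one>} \<in> ?T"
    using one_is_normal V(3) V.one_closed by blast
  then obtain W where W: "W \<lhd> G" "W \<subset> V"
    and max: "\<And>W'. W' \<lhd> G \<Longrightarrow> W' \<subset> V \<Longrightarrow> W \<subseteq> W' \<Longrightarrow> W' = W"
    using finite_has_maximal[OF finT] by (metis (lifting) empty_iff mem_Collect_eq)
  note Ws = normal_imp_subgroup[OF W(1)]
  have Wpos: "card W > 0"
    by (rule card_subgroup_pos[OF Ws fin])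
  obtain D L d n where DL: "D \<lhd> G" "L \<lhd> G" "V \<subseteq> D" "D \<subseteq> L" "Up_series p G L (carrier G)"
    and c: "card D = d * card V" "\<not> p dvd d" "card L = p ^ n * card D"
    using above unfolding NpUp_above_def by blast
  define e where "e = order (G\<lparr>carrier := V\<rparr> Mod W)"
  have e: "card V = e * card W"
    using order_Mod_update[OF V.subgroup_axioms Ws] W(2) unfolding e_def by auto
  have "chief_factor G V W"
    unfolding chief_factor_def using V(1) W max by blast
  then have "p_group p (G\<lparr>carrier := V\<rparr> Mod W) \<or> p'_group p (G\<lparr>carrier := V\<rparr> Mod W)"
    using sol unfolding p_solvable_def by blast
  then have "(\<exists>k. e = p ^ k) \<or> \<not> p dvd e"
    unfolding p_group_def p'_group_def e_def by blast
  then have "NpUp_above p G W"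
  proof
    assume "\<not> p dvd e"
    then have "\<not> p dvd d * e"
      using c(2) p prime_dvd_mult_iff by blast
    moreover have "card D = (d * e) * card W"
      using c(1) e by simp
    moreover have "W \<subseteq> D"
      using W(2) DL(3) by blast
    ultimately show ?thesis
      unfolding NpUp_above_def using DL c(3) by blast
  next
    assume "\<exists>k. e = p ^ k"
    then obtain k where k: "card V = p ^ k * card W"
      using e by blast
    have k0: "k > 0"
    proof (rule ccontr)
      assume "\<not> k > 0"
      then have "card W = card V" using k by simp
      then show False
        using W(2) psubset_card_mono[OF finite_subset[OF V.subset fin] W(2)] by simp
    qed
    let ?\<pi> = "\<lambda>x. W #> x"
    interpret quot: finite_epi G "G Mod W" ?\<pi>
      by (rule finite_epi_Mod[OF W(1) fin])
    note ker = kernel_Mod[OF W(1)]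
    let ?M = "?\<pi> ` V" and ?K = "?\<pi> ` D"
    have Mn: "?M \<lhd> G Mod W" and Kn: "?K \<lhd> G Mod W"
      using quot.normal_image[OF V(1)] quot.normal_image[OF DL(1)] by auto
    have "card ?M * card (V \<inter> W) = card V"
      using quot.card_image_kernel[OF V.subgroup_axioms] unfolding ker .
    moreover have "V \<inter> W = W"
      using W(2) by blast
    ultimately have cM: "card ?M = p ^ k"
      using k Wpos by simp
    have "card ?K * card (D \<inter> W) = card D"
      using quot.card_image_kernel[OF normal_imp_subgroup[OF DL(1)]] unfolding ker .
    moreover have "D \<inter> W = W"
      using W(2) DL(3) by blast
    ultimately have "card ?K * card W = (d * card ?M) * card W"
      using c(1) k cM by (simp add: mult.assoc)
    then have cK: "card ?K = d * card ?M"
      using Wpos by simp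
    have min: "U = {\<one>\<^bsub>G Mod W\<^esub>} \<or> U = ?M" if U: "U \<lhd> G Mod W" "U \<subseteq> ?M" for U
    proof -
      let ?U = "?\<pi> -` U \<inter> carrier G"
      have Un: "?U \<lhd> G"
        by (rule quot.normal_vimage[OF U(1)])
      have "?U \<subseteq> ?\<pi> -` ?M \<inter> carrier G"
        by (rule Int_mono[OF vimage_mono[OF U(2)] order_refl])
      also have "\<dots> = V"
        using quot.vimage_image[OF V.subgroup_axioms] psubset_imp_subset[OF W(2)] unfolding ker .
      finally have UV: "?U \<subseteq> V" .
      have "\<one>\<^bsub>G Mod W\<^esub> \<in> U"
        by (rule subgroup.one_closed[OF normal_imp_subgroup[OF U(1)]])
      then have "W \<subseteq> ?U"
        using quot.kernel_eq_vimage unfolding ker by blast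
      then have "?U = W \<or> ?U = V"
        using max[OF Un] UV by blast
      moreover have "?\<pi> ` ?U = U"
        using subgroup.subset[OF normal_imp_subgroup[OF U(1)]] unfolding quot.surj[symmetric] by blast
      moreover have "?\<pi> ` W = {\<one>\<^bsub>G Mod W\<^esub>}"
      proof -
        have "?\<pi> w = \<one>\<^bsub>G Mod W\<^esub>" if "w \<in> W" for w
          using that ker by (auto simp: kernel_def)
        then show ?thesis
          using subgroup.one_closed[OF Ws] by blast
      qed
      ultimately show ?thesis
        by metis
    qed
    have ab: "x \<otimes>\<^bsub>G Mod W\<^esub> y = y \<otimes>\<^bsub>G Mod W\<^esub> x" if "x \<in> ?M" "y \<in> ?M" for x y
      by (rule quot.H.minimal_normal_p_subgroup_abelian[OF p Mn cM k0 min that])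
    have Vab: "?\<pi> (x \<otimes> y) = ?\<pi> (y \<otimes> x)" if "x \<in> V" "y \<in> V" for x y
      using ab[OF imageI[OF that(1)] imageI[OF that(2)]] that
        quot.hom_mult[of x y] quot.hom_mult[of y x] by simp
    let ?C = "{y \<in> ?M. \<forall>k\<in>?K. k \<otimes>\<^bsub>G Mod W\<^esub> y \<otimes>\<^bsub>G Mod W\<^esub> inv\<^bsub>G Mod W\<^esub> k = y}"
    have "?C = {\<one>\<^bsub>G Mod W\<^esub>} \<or> ?C = ?M"
      by (rule min[OF quot.H.fixed_points_normal[OF Mn Kn]]) blast
    then show ?thesis
    proof
      assume C: "?C = ?M"
      have "?\<pi> (x \<otimes> y) = ?\<pi> (y \<otimes> x)" if x: "x \<in> D" and y: "y \<in> V" for x y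
      proof -
        have xc: "x \<in> carrier G" "y \<in> carrier G"
          using subgroup.mem_carrier[OF normal_imp_subgroup[OF DL(1)] x] y by auto
        have "?\<pi> y \<in> ?C"
          by (subst C) (rule imageI[OF y])
        then have "\<forall>k\<in>?K. k \<otimes>\<^bsub>G Mod W\<^esub> ?\<pi> y \<otimes>\<^bsub>G Mod W\<^esub> inv\<^bsub>G Mod W\<^esub> k = ?\<pi> y"
          unfolding mem_Collect_eq by (rule conjunct2)
        then have "?\<pi> x \<otimes>\<^bsub>G Mod W\<^esub> ?\<pi> y \<otimes>\<^bsub>G Mod W\<^esub> inv\<^bsub>G Mod W\<^esub> ?\<pi> x = ?\<pi> y"
          using imageI[OF x] by (rule bspec)
        then have "?\<pi> x \<otimes>\<^bsub>G Mod W\<^esub> ?\<pi> y = ?\<pi> y \<otimes>\<^bsub>G Mod W\<^esub> ?\<pi> x"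
          by (rule quot.H.conj_fixed_imp_commute[OF quot.hom_closed[OF xc(1)] quot.hom_closed[OF xc(2)]])
        then show ?thesis
          using quot.hom_mult[OF xc] quot.hom_mult[OF xc(2,1)] by metis
      qed
      then show ?thesis
        using NpUp_above_central_step[OF p fin W(1) _ V(1) k DL c] Vab W(2) by blast
    next
      assume C: "?C = {\<one>\<^bsub>G Mod W\<^esub>}"
      interpret sec: abelian_normal_section "G Mod W" ?M ?K
        by (intro abelian_normal_section.intro abelian_normal_section_axioms.intro quot.H.group_axioms
            quot.fin_img Mn Kn image_mono[OF DL(3)] ab)
      have cop: "coprime d (card ?M)"
        unfolding cM using prime_imp_coprime[OF p c(2)] by (simp add: coprime_commute)
      have fpf: "y = \<one>\<^bsub>G Mod W\<^esub>"
        if "y \<in> ?M" "\<forall>k\<in>?K. k \<otimes>\<^bsub>G Mod W\<^esub> y \<otimes>\<^bsub>G Mod W\<^esub> inv\<^bsub>G Mod W\<^esub> k = y" for y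
      proof -
        have "y \<in> ?C"
          using that by (intro CollectI conjI)
        then show ?thesis
          unfolding C by (rule singletonD)
      qed
      have "\<exists>J. subgroup J (G Mod W) \<and> J \<inter> ?M = {\<one>\<^bsub>G Mod W\<^esub>} \<and>
          (\<forall>g\<in>carrier (G Mod W). \<exists>m\<in>?M. m \<otimes>\<^bsub>G Mod W\<^esub> g \<in> J)"
        by (rule sec.fixed_point_free_complement[OF _ cK cop]) (rule fpf)
      then obtain J where J: "subgroup J (G Mod W)" "J \<inter> ?M = {\<one>\<^bsub>G Mod W\<^esub>}"
        and JM: "\<forall>g\<in>carrier (G Mod W). \<exists>m\<in>?M. m \<otimes>\<^bsub>G Mod W\<^esub> g \<in> J"
        by (elim exE conjE)
      \<comment> \<open>The complement to \<open>V/W\<close>, pulled back to \<open>G\<close>.\<close>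
      let ?H = "?\<pi> -` J \<inter> carrier G"
      have H1: "subgroup ?H G"
        by (rule quot.subgroup_vimage[OF J(1)])
      have H2: "?H \<inter> V \<subseteq> W"
      proof
        fix x assume x: "x \<in> ?H \<inter> V"
        then have "?\<pi> x \<in> J \<inter> ?M"
          by blast
        then have "x \<in> kernel G (G Mod W) ?\<pi>"
          using J(2) x unfolding kernel_def by blast
        then show "x \<in> W"
          unfolding ker .
      qed
      have H3: "\<exists>v\<in>V. v \<otimes> g \<in> ?H" if g: "g \<in> carrier G" for g
      proof -
        obtain v where v: "v \<in> V" "?\<pi> v \<otimes>\<^bsub>G Mod W\<^esub> ?\<pi> g \<in> J"
          using bspec[OF JM quot.hom_closed[OF g]] by (elim bexE imageE) simp
        then have "?\<pi> (v \<otimes> g) \<in> J"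
          using quot.hom_mult[OF V.mem_carrier[OF v(1)] g] by metis
        then show ?thesis
          using v(1) g V.mem_carrier[OF v(1)] by blast
      qed
      obtain N where N: "V \<subseteq> N" "Up_series p G N (carrier G)"
        and Nc: "\<And>x. x \<in> N \<Longrightarrow> \<exists>v\<in>V. \<exists>s. x = v \<otimes> s \<and> s \<in> carrier G \<and> (\<forall>y\<in>V. ?\<pi> (s \<otimes> y) = ?\<pi> (y \<otimes> s))"
        using NpUp_above_supplement_step[OF p fin W(1) V(1,2) H1 H2 H3] by blast
      note Nn = Up_series_normal(1)[OF N(2)]
      \<comment> \<open>Cut \<open>D\<close> and \<open>L\<close> down to \<open>N\<close>, which centralizes \<open>V/W\<close>.\<close>
      have Dn: "D \<inter> N \<lhd> G" and Ln: "L \<inter> N \<lhd> G"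
        using normal_subgroup_intersect DL(1,2) Nn by auto
      have "carrier G \<inter> L = L"
        using Up_series_normal(3)[OF DL(5)] by blast
      then have "Up_series p G (L \<inter> N) L"
        using Up_series_Int[OF p fin DL(2) N(2)] by (simp add: Int_commute)
      then have Ls: "Up_series p G (L \<inter> N) (carrier G)"
        by (rule Up_series_trans[OF DL(5)])
      have "V \<inter> N = V"
        using N(1) by blast
      then obtain d' where d': "card (D \<inter> N) = d' * card V" "d' dvd d"
        using index_Int[OF fin V(1) DL(1) Nn DL(3) c(1)] by metis
      obtain f where f: "card (L \<inter> N) = f * card (D \<inter> N)" "f dvd p ^ n"
        using index_Int[OF fin DL(1,2) Nn DL(4) c(3)] by blast
      obtain n' where "f = p ^ n'"
        using f(2) unfolding divides_primepow_nat[OF p] by blast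
      then have n': "card (L \<inter> N) = p ^ n' * card (D \<inter> N)"
        using f(1) by simp
      have nd: "\<not> p dvd d'"
        using c(2) d'(2) dvd_trans by blast
      have "?\<pi> (x \<otimes> y) = ?\<pi> (y \<otimes> x)" if x: "x \<in> D \<inter> N" and y: "y \<in> V" for x y
      proof -
        obtain v s where vs: "v \<in> V" "x = v \<otimes> s" "s \<in> carrier G" "?\<pi> (s \<otimes> y) = ?\<pi> (y \<otimes> s)"
          using Nc[of x] x y by blast
        have cc: "v \<in> carrier G" "y \<in> carrier G"
          using vs(1) y by auto
        have "?\<pi> (x \<otimes> y) = ?\<pi> v \<otimes>\<^bsub>G Mod W\<^esub> ?\<pi> (s \<otimes> y)"
          using vs(2,3) cc quot.hom_mult[of v "s \<otimes> y"] by (simp add: m_assoc)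
        also have "\<dots> = ?\<pi> (v \<otimes> y) \<otimes>\<^bsub>G Mod W\<^esub> ?\<pi> s"
          unfolding vs(4) using vs(3) cc quot.hom_mult[of v "y \<otimes> s"] quot.hom_mult[of "v \<otimes> y" s]
          by (simp add: m_assoc)
        also have "\<dots> = ?\<pi> (y \<otimes> x)"
          unfolding Vab[OF vs(1) y] using vs(2,3) cc quot.hom_mult[of "y \<otimes> v" s]
          by (simp add: m_assoc)
        finally show ?thesis .
      qed
      note central = this
      have VD: "V \<subseteq> D \<inter> N" and DLN: "D \<inter> N \<subseteq> L \<inter> N"
        using DL(3,4) N(1) by auto
      show ?thesis
        by (rule NpUp_above_central_step[OF p fin W(1) _ V(1) k Dn Ln VD DLN Ls d'(1) nd n' Vab central])
          (rule psubset_imp_subset[OF W(2)])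
    qed
  qed
  then show ?thesis
    using W by blast
qed

theorem theorem5p1:
  fixes p :: nat and G :: "('a, 'b) monoid_scheme"
  assumes "Factorial_Ring.prime p" and "finite_group G" and "p_solvable p G"
  shows "NpUp p G \<longleftrightarrow> NpUp p (G Mod Up_norm p G)"
proof -
  interpret group G
    using assms(2) by (simp add: finite_group_def)
  have fin: "finite (carrier G)"
    using assms(2) by (simp add: finite_group_def)
  let ?N = "Up_norm p G"
  have N: "?N \<lhd> G"
    by (rule Up_norm_normal[OF assms(1) fin])
  interpret quot: finite_epi G "G Mod ?N" "\<lambda>x. ?N #>\<^bsub>G\<^esub> x"
    by (rule finite_epi_Mod[OF N fin])
  show ?thesis
    unfolding NpUp_iff_above[OF assms(1) fin] quot.H.NpUp_iff_above[OF assms(1) quot.fin_img]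
  proof
    assume "NpUp_above p G {\<one>\<^bsub>G\<^esub>}"
    then have "NpUp_above p (G Mod ?N) ((\<lambda>x. ?N #>\<^bsub>G\<^esub> x) ` {\<one>\<^bsub>G\<^esub>})"
      by (rule quot.NpUp_above_image[OF assms(1) one_is_normal])
    then show "NpUp_above p (G Mod ?N) {\<one>\<^bsub>G Mod ?N\<^esub>}"
      using quot.hom_one by simp
  next
    assume "NpUp_above p (G Mod ?N) {\<one>\<^bsub>G Mod ?N\<^esub>}"
    then have "NpUp_above p G ?N"
      using quot.NpUp_above_vimage[OF quot.H.one_is_normal] quot.kernel_eq_vimage kernel_Mod[OF N]
      by metis
    moreover have "NpUp_above p G {\<one>\<^bsub>G\<^esub>}"
      if "V \<lhd> G" "V \<subseteq> ?N" "NpUp_above p G V" for V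
      using that
    proof (induction "card V" arbitrary: V rule: less_induct)
      case less
      show ?case
      proof (cases "V = {\<one>\<^bsub>G\<^esub>}")
        case False
        then obtain W where W: "W \<lhd> G" "W \<subset> V" "NpUp_above p G W"
          using NpUp_above_descend[OF assms(1) fin assms(3) less.prems(1,2) _ less.prems(3)] by blast
        have "finite V"
          using finite_subset[OF subgroup.subset[OF normal_imp_subgroup[OF less.prems(1)]] fin] .
        then have "card W < card V"
          using W(2) by (rule psubset_card_mono)
        then show ?thesis
          using less.hyps[OF _ W(1) _ W(3)] W(2) less.prems(2) by blast
      qed (use less.prems in simp)
    qed
    ultimately show "NpUp_above p G {\<one>\<^bsub>G\<^esub>}"
      using N by blast
  qed
qed

end
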